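(* Let $T$ be a tree of order $n \geq 2$ with diameter $d$ and with $p$ pendant vertices, and let $T_{\mathbf{1}}$ be the whiskered graph of $T$. Let $K$ be a field, let $S = K[V(T_{\mathbf{1}})]$ be the polynomial ring over $K$ whose variables are the vertices of $T_{\mathbf{1}}$, and let $I = I(T_{\mathbf{1}})\subset S$ be the edge ideal of $T_{\mathbf{1}}$. Then $$\operatorname{reg}(S/I)\leq \min\left\{\left\lceil\frac{2n-d-1}{2}\right\rceil,\left\lfloor\frac{2n+p-2}{3}\right\rfloor\right\}.$$
   Context: All graphs are finite and simple. A tree is a connected acyclic graph; its order is its number of vertices. The diameter of a graph is the maximum distance between two of its vertices. A pendant vertex is a vertex of degree one. Here $n$, $d$, $p$ refer to $T$, not to $T_{\mathbf{1}}$. For a graph $G$ with vertex set $\{x_1,\dots,x_n\}$, the whiskered graph $G_{\mathbf{1}}$ is obtained from $G$ by adding, for each $i=1,\dots,n$, one new vertex $y_i$ and the edge $\{x_i,y_i\}$. For a graph $H$ with edge set $E(H)$, the edge ideal $I(H)$ is the squarefree monomial ideal of $K[V(H)]$ generated by the products $uv$ with $\{u,v\}\in E(H)$; $K[V(H)]$ carries the standard grading. For a finitely generated graded module $M$ over a standard graded polynomial ring, with graded Betti numbers $\beta_{i,j}(M)$ (the number of copies of $S(-j)$ in homological degree $i$ of the minimal graded free resolution), the Castelnuovo-Mumford regularity is $\operatorname{reg}(M)=\max\{j-i : \beta_{i,j}(M)\neq 0\}$. *)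

theory Defs
  imports
    "Jordan_Normal_Form.Matrix"
    "HOL-Algebra.Module"
    "HOL-Algebra.QuotRing"
    "HOL-Library.Poly_Mapping"
begin

section \<open>Finite simple graphs and trees\<close>

record 'v ugraph =
  vertices :: "'v set"
  edges :: "'v set set"

definition simple_graph :: "'v ugraph \<Rightarrow> bool" where
  "simple_graph G \<longleftrightarrow>
     finite (vertices G) \<and> (\<forall>e\<in>edges G. e \<subseteq> vertices G \<and> card e = 2)"

definition walk :: "'v ugraph \<Rightarrow> 'v list \<Rightarrow> bool" where
  "walk G xs \<longleftrightarrow> xs \<noteq> [] \<and> set xs \<subseteq> vertices G \<and>
     (\<forall>i. Suc i < length xs \<longrightarrow> {xs ! i, xs ! Suc i} \<in> edges G)"

definition walk_between :: "'v ugraph \<Rightarrow> 'v \<Rightarrow> 'v list \<Rightarrow> 'v \<Rightarrow> bool" where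
  "walk_between G u xs v \<longleftrightarrow> walk G xs \<and> hd xs = u \<and> last xs = v"

definition connected_graph :: "'v ugraph \<Rightarrow> bool" where
  "connected_graph G \<longleftrightarrow> vertices G \<noteq> {} \<and>
     (\<forall>u\<in>vertices G. \<forall>v\<in>vertices G. \<exists>xs. walk_between G u xs v)"

text \<open>A cycle is given by the list of its distinct vertices; the edge from the last
  to the first one closes it.\<close>

definition graph_cycle :: "'v ugraph \<Rightarrow> 'v list \<Rightarrow> bool" where
  "graph_cycle G xs \<longleftrightarrow>
     walk G xs \<and> distinct xs \<and> 3 \<le> length xs \<and> {last xs, hd xs} \<in> edges G"

definition is_tree :: "'v ugraph \<Rightarrow> bool" where
  "is_tree G \<longleftrightarrow> simple_graph G \<and> connected_graph G \<and> (\<nexists>xs. graph_cycle G xs)"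

text \<open>The length of a walk is its number of edges, one less than the number of listed
  vertices. The distance is only meaningful for vertices in the same component.\<close>

definition graph_dist :: "'v ugraph \<Rightarrow> 'v \<Rightarrow> 'v \<Rightarrow> nat" where
  "graph_dist G u v = (LEAST k. \<exists>xs. walk_between G u xs v \<and> length xs = Suc k)"

definition graph_diameter :: "'v ugraph \<Rightarrow> nat" where
  "graph_diameter G = Max {graph_dist G u v | u v. u \<in> vertices G \<and> v \<in> vertices G}"

definition vertex_degree :: "'v ugraph \<Rightarrow> 'v \<Rightarrow> nat" where
  "vertex_degree G v = card {e \<in> edges G. v \<in> e}"

definition pendant_vertices :: "'v ugraph \<Rightarrow> 'v set" where
  "pendant_vertices G = {v \<in> vertices G. vertex_degree G v = 1}"

text \<open>In the whiskered graph, \<open>Inl v\<close> is the original vertex \<open>v\<close> and \<open>Inr v\<close> the new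
  vertex attached to it.\<close>

definition whisker :: "'v ugraph \<Rightarrow> ('v + 'v) ugraph" where
  "whisker G = \<lparr> vertices = Inl ` vertices G \<union> Inr ` vertices G,
     edges = (\<lambda>e. Inl ` e) ` edges G \<union> (\<lambda>v. {Inl v, Inr v}) ` vertices G \<rparr>"


section \<open>Polynomial rings with the standard grading, edge ideals\<close>

text \<open>A monomial is its exponent vector, a polynomial the finitely supported family of
  its coefficients; \<open>(*)\<close> on \<^typ>\<open>('x \<Rightarrow>\<^sub>0 nat) \<Rightarrow>\<^sub>0 'k::field\<close> is the convolution product.\<close>

type_synonym ('x, 'k) mpoly = "('x \<Rightarrow>\<^sub>0 nat) \<Rightarrow>\<^sub>0 'k"

definition poly_ring :: "'x set \<Rightarrow> ('x, 'k::field) mpoly ring" where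
  "poly_ring X = \<lparr> carrier = {f. \<forall>m\<in>Poly_Mapping.keys f. Poly_Mapping.keys m \<subseteq> X},
     monoid.mult = (*), one = 1, zero = 0, add = (+) \<rparr>"

definition variable :: "'x \<Rightarrow> ('x, 'k::field) mpoly" where
  "variable x = Poly_Mapping.single (Poly_Mapping.single x 1) 1"

definition monomial_degree :: "('x \<Rightarrow>\<^sub>0 nat) \<Rightarrow> nat" where
  "monomial_degree m = (\<Sum>x\<in>Poly_Mapping.keys m. Poly_Mapping.lookup m x)"

text \<open>The graded component of degree \<open>j\<close>; it is zero for negative \<open>j\<close>.\<close>

definition poly_component :: "'x set \<Rightarrow> int \<Rightarrow> ('x, 'k::field) mpoly set" where
  "poly_component X j =
     {f \<in> carrier (poly_ring X). \<forall>m\<in>Poly_Mapping.keys f. int (monomial_degree m) = j}"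

text \<open>The homogeneous maximal ideal, consisting of the polynomials without constant
  term.\<close>

definition irrelevant_ideal :: "'x set \<Rightarrow> ('x, 'k::field) mpoly set" where
  "irrelevant_ideal X = {f \<in> carrier (poly_ring X). Poly_Mapping.lookup f 0 = 0}"

definition edge_ideal :: "'v ugraph \<Rightarrow> ('v, 'k::field) mpoly set" where
  "edge_ideal G = Idl\<^bsub>poly_ring (vertices G)\<^esub>
     {variable u * variable v | u v. {u, v} \<in> edges G}"


section \<open>Quotients as graded modules\<close>

definition quotient_module :: "('a, 'b) ring_scheme \<Rightarrow> 'a set \<Rightarrow> ('a, 'a set) module" where
  "quotient_module R I = \<lparr> carrier = carrier (R Quot I), monoid.mult = monoid.mult (R Quot I),
     one = one (R Quot I), zero = zero (R Quot I), add = add (R Quot I),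
     smult = (\<lambda>a C. (I +>\<^bsub>R\<^esub> a) \<otimes>\<^bsub>R Quot I\<^esub> C) \<rparr>"

definition quotient_component ::
    "'x set \<Rightarrow> ('x, 'k::field) mpoly set \<Rightarrow> int \<Rightarrow> ('x, 'k) mpoly set set" where
  "quotient_component X I j = (\<lambda>f. I +>\<^bsub>poly_ring X\<^esub> f) ` poly_component X j"


section \<open>Minimal graded free resolutions, Betti numbers, regularity\<close>

text \<open>A complex \<open>\<dots> \<rightarrow> F\<^sub>2 \<rightarrow> F\<^sub>1 \<rightarrow> F\<^sub>0 \<rightarrow> M\<close> of graded free modules of finite rank over
  \<open>S = K[X]\<close>: \<open>F\<^sub>i\<close> is the direct sum of the \<open>S(-j)\<close>, where \<open>j\<close> runs through the list
  \<open>shifts F i\<close> of degrees of its basis elements, \<open>differential F i\<close> is the matrix of the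
  map from \<open>F\<^sub>i\<^sub>+\<^sub>1\<close> to \<open>F\<^sub>i\<close>, and \<open>generators F\<close> lists the images in \<open>M\<close> of the basis
  elements of \<open>F\<^sub>0\<close>.\<close>

record ('r, 'm) free_complex =
  shifts :: "nat \<Rightarrow> int list"
  differential :: "nat \<Rightarrow> 'r mat"
  generators :: "'m list"

definition free_module ::
    "'x set \<Rightarrow> (('x, 'k::field) mpoly, 'm) free_complex \<Rightarrow> nat \<Rightarrow> ('x, 'k) mpoly vec set" where
  "free_module X F i =
     {v \<in> carrier_vec (length (shifts F i)). set\<^sub>v v \<subseteq> carrier (poly_ring X)}"

definition augmentation ::
    "(('x, 'k::field) mpoly, 'm) module \<Rightarrow> (('x, 'k) mpoly, 'm) free_complex
       \<Rightarrow> ('x, 'k) mpoly vec \<Rightarrow> 'm" where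
  "augmentation M F v =
     (\<Oplus>\<^bsub>M\<^esub>k\<in>{..<length (shifts F 0)}. (v $ k) \<odot>\<^bsub>M\<^esub> (generators F ! k))"

text \<open>\<open>gr j\<close> is the graded component of degree \<open>j\<close> of the module \<open>M\<close>. The first four
  conditions say that the data define maps homogeneous of degree 0, the last three that the
  augmented complex is exact.\<close>

definition graded_free_resolution ::
    "'x set \<Rightarrow> (('x, 'k::field) mpoly, 'm) module \<Rightarrow> (int \<Rightarrow> 'm set)
       \<Rightarrow> (('x, 'k) mpoly, 'm) free_complex \<Rightarrow> bool" where
  "graded_free_resolution X M gr F \<longleftrightarrow>
     length (generators F) = length (shifts F 0) \<and>
     (\<forall>k<length (shifts F 0). generators F ! k \<in> gr (shifts F 0 ! k)) \<and>
     (\<forall>i. differential F i \<in> carrier_mat (length (shifts F i)) (length (shifts F (Suc i)))) \<and>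
     (\<forall>i. \<forall>r<length (shifts F i). \<forall>c<length (shifts F (Suc i)).
        differential F i $$ (r, c)
          \<in> poly_component X (shifts F (Suc i) ! c - shifts F i ! r)) \<and>
     augmentation M F ` free_module X F 0 = carrier M \<and>
     {v \<in> free_module X F 0. augmentation M F v = \<zero>\<^bsub>M\<^esub>}
       = (\<lambda>w. differential F 0 *\<^sub>v w) ` free_module X F 1 \<and>
     (\<forall>i. {v \<in> free_module X F (Suc i). differential F i *\<^sub>v v = 0\<^sub>v (length (shifts F i))}
       = (\<lambda>w. differential F (Suc i) *\<^sub>v w) ` free_module X F (Suc (Suc i)))"

text \<open>Minimality: the image of \<open>F\<^sub>i\<^sub>+\<^sub>1\<close> lies in \<open>\<mm> F\<^sub>i\<close>, where \<open>\<mm>\<close> is the homogeneous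
  maximal ideal.\<close>

definition minimal_graded_free_resolution ::
    "'x set \<Rightarrow> (('x, 'k::field) mpoly, 'm) module \<Rightarrow> (int \<Rightarrow> 'm set)
       \<Rightarrow> (('x, 'k) mpoly, 'm) free_complex \<Rightarrow> bool" where
  "minimal_graded_free_resolution X M gr F \<longleftrightarrow>
     graded_free_resolution X M gr F \<and>
     (\<forall>i. elements_mat (differential F i) \<subseteq> irrelevant_ideal X)"

text \<open>A finitely generated graded module has a minimal graded free resolution, unique up
  to isomorphism, so that the choice made here does not matter.\<close>

definition graded_betti ::
    "'x set \<Rightarrow> (('x, 'k::field) mpoly, 'm) module \<Rightarrow> (int \<Rightarrow> 'm set)
       \<Rightarrow> nat \<Rightarrow> int \<Rightarrow> nat" where
  "graded_betti X M gr i j =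
     count_list (shifts (SOME F. minimal_graded_free_resolution X M gr F) i) j"

definition regularity ::
    "'x set \<Rightarrow> (('x, 'k::field) mpoly, 'm) module \<Rightarrow> (int \<Rightarrow> 'm set) \<Rightarrow> int" where
  "regularity X M gr = Max {j - int i | i j. graded_betti X M gr i j \<noteq> 0}"

end

theory Submission
  imports Defs
begin

text \<open>The proof combines an upper bound for the regularity of edge ideals of forests with an
elementary estimate for independent sets in trees.

For a forest, the regularity of \<open>S/I\<close> is at most the induced matching number, and a finite
minimal free resolution can be built edge by edge. If \<open>{u, v}\<close> is an edge with a leaf \<open>u\<close> and
\<open>J\<close> is the ideal of the remaining edges, then \<open>J : uv = J : v\<close>, and multiplication by \<open>uv\<close>
gives an exact sequence \<open>0 \<rightarrow> S/(J : v)(-2) \<rightarrow> S/J \<rightarrow> S/(J + (uv)) \<rightarrow> 0\<close>. Its first map factors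
through multiplication by the variable \<open>u\<close>, so the mapping cone of the two given minimal
resolutions is again minimal (lemma \<open>mapping_cone\<close>). The ideal \<open>J : v\<close> is generated by the
other neighbours of \<open>v\<close> and by the edges that avoid \<open>v\<close> and its neighbours, and \<open>{u, v}\<close>
extends every induced matching of the latter. Hence the induction in \<open>regularity_forest\<close> works.

The regularity in the statement refers to an unspecified minimal resolution. By the usual
comparison argument (\<open>minimal_resolution_shifts\<close>, \<open>regularity_le\<close>) its shifts occur among those
of the constructed one.

The whiskered tree is a forest, and each member of an induced matching in it contains an
original vertex; these vertices are independent in \<open>T\<close> (\<open>whisker_induced_matching\<close>). So the
regularity is at most the size of an independent set \<open>A\<close> of \<open>T\<close>. A path of length \<open>d\<close> without
repeated vertices contains at most half of its \<open>d + 1\<close> vertices, rounded up, from \<open>A\<close>, which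
gives the first bound. Counting the edges at the vertices of \<open>A\<close> gives
\<open>2 |A| \<le> n - 1 + p\<close>, which implies the second bound if \<open>p < n\<close>; if every vertex is pendant, it
follows from \<open>|A| \<le> n - 1\<close>.\<close>

section \<open>Polynomials and their homogeneous parts\<close>

abbreviation polys :: "'x set \<Rightarrow> ('x, 'k::field) mpoly set" where
  "polys X \<equiv> carrier (poly_ring X)"

lemma polys_iff: "f \<in> polys X \<longleftrightarrow> (\<forall>m\<in>Poly_Mapping.keys f. Poly_Mapping.keys m \<subseteq> X)"
  by (simp add: poly_ring_def)

lemma keys_exponent_add:
  "Poly_Mapping.keys (a + b :: 'x \<Rightarrow>\<^sub>0 nat) = Poly_Mapping.keys a \<union> Poly_Mapping.keys b"
  by (auto simp: in_keys_iff lookup_add)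

lemma monomial_degree_superset:
  assumes "finite A" "Poly_Mapping.keys m \<subseteq> A"
  shows "monomial_degree m = (\<Sum>x\<in>A. Poly_Mapping.lookup m x)"
  unfolding monomial_degree_def
  by (rule sum.mono_neutral_left) (use assms in \<open>auto simp: in_keys_iff\<close>)

lemma monomial_degree_add: "monomial_degree (a + b) = monomial_degree a + monomial_degree b"
proof -
  let ?A = "Poly_Mapping.keys a \<union> Poly_Mapping.keys b"
  have "monomial_degree (a + b) = (\<Sum>x\<in>?A. Poly_Mapping.lookup (a + b) x)"
    by (rule monomial_degree_superset) (auto simp: keys_exponent_add)
  also have "\<dots> = (\<Sum>x\<in>?A. Poly_Mapping.lookup a x) + (\<Sum>x\<in>?A. Poly_Mapping.lookup b x)"
    by (simp add: lookup_add sum.distrib)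
  also have "\<dots> = monomial_degree a + monomial_degree b"
    by (simp add: monomial_degree_superset[of ?A])
  finally show ?thesis .
qed

lemma monomial_degree_0 [simp]: "monomial_degree 0 = 0"
  by (simp add: monomial_degree_def)

lemma polys_0 [simp]: "0 \<in> polys X"
  and polys_1 [simp]: "1 \<in> polys X"
  by (simp_all add: polys_iff)

lemma polys_add: "f \<in> polys X \<Longrightarrow> g \<in> polys X \<Longrightarrow> f + g \<in> polys X"
  using keys_add[of f g] by (auto simp: polys_iff)

lemma polys_mult: "f \<in> polys X \<Longrightarrow> g \<in> polys X \<Longrightarrow> f * g \<in> polys X"
  using keys_mult[of f g] by (fastforce simp: polys_iff keys_exponent_add)

lemma keys_minus_subset:
  fixes f :: "'a \<Rightarrow>\<^sub>0 'b::ab_group_add"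
  shows "Poly_Mapping.keys (f - g) \<subseteq> Poly_Mapping.keys f \<union> Poly_Mapping.keys g"
  by (auto simp: in_keys_iff lookup_minus)

lemma keys_uminus_eq [simp]:
  fixes f :: "'a \<Rightarrow>\<^sub>0 'b::ab_group_add"
  shows "Poly_Mapping.keys (- f) = Poly_Mapping.keys f"
  by (auto simp: in_keys_iff)

lemma polys_uminus: "f \<in> polys X \<Longrightarrow> - f \<in> polys X"
  by (simp add: polys_iff)

lemma polys_minus: "f \<in> polys X \<Longrightarrow> g \<in> polys X \<Longrightarrow> f - g \<in> polys X"
  using keys_minus_subset[of f g] by (auto simp: polys_iff)

lemma polys_sum: "(\<And>a. a \<in> A \<Longrightarrow> f a \<in> polys X) \<Longrightarrow> sum f A \<in> polys X"
  by (induction A rule: infinite_finite_induct) (auto intro: polys_add)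

lemma poly_component_iff:
  "f \<in> poly_component X j \<longleftrightarrow>
     f \<in> polys X \<and> (\<forall>m\<in>Poly_Mapping.keys f. int (monomial_degree m) = j)"
  by (simp add: poly_component_def)

lemma component_polys: "f \<in> poly_component X j \<Longrightarrow> f \<in> polys X"
  by (simp add: poly_component_iff)

lemma component_0 [simp]: "0 \<in> poly_component X j"
  by (simp add: poly_component_iff)

lemma component_1 [simp]: "1 \<in> poly_component X 0"
  by (simp add: poly_component_iff)

lemma component_add:
  "f \<in> poly_component X j \<Longrightarrow> g \<in> poly_component X j \<Longrightarrow> f + g \<in> poly_component X j"
  using keys_add[of f g] by (auto simp: poly_component_iff intro: polys_add)

lemma component_uminus: "f \<in> poly_component X j \<Longrightarrow> - f \<in> poly_component X j"
  by (auto simp: poly_component_iff intro: polys_uminus)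

lemma component_minus:
  "f \<in> poly_component X j \<Longrightarrow> g \<in> poly_component X j \<Longrightarrow> f - g \<in> poly_component X j"
  using keys_minus_subset[of f g] by (auto simp: poly_component_iff intro: polys_minus)

lemma component_mult:
  assumes f: "f \<in> poly_component X i" and g: "g \<in> poly_component X j"
  shows "f * g \<in> poly_component X (i + j)"
  using keys_mult[of f g] assms
  by (fastforce simp: poly_component_iff monomial_degree_add intro: polys_mult)

lemma component_sum:
  "(\<And>a. a \<in> A \<Longrightarrow> f a \<in> poly_component X j) \<Longrightarrow> sum f A \<in> poly_component X j"
  by (induction A rule: infinite_finite_induct) (auto intro: component_add)

text \<open>Homogeneous parts turn an arbitrary solution of a homogeneous linear system into a
homogeneous one, which is what makes all comparison maps below graded.\<close>

lift_definition homogeneous_part :: "int \<Rightarrow> ('x, 'k::field) mpoly \<Rightarrow> ('x, 'k) mpoly" is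
  "\<lambda>j f m. if int (monomial_degree m) = j then f m else 0"
  by (erule finite_subset[rotated]) auto

lemma lookup_homogeneous_part:
  "Poly_Mapping.lookup (homogeneous_part j f) m =
     (if int (monomial_degree m) = j then Poly_Mapping.lookup f m else 0)"
  by transfer simp

lemma keys_homogeneous_part:
  "Poly_Mapping.keys (homogeneous_part j f) = {m \<in> Poly_Mapping.keys f. int (monomial_degree m) = j}"
  by (auto simp: in_keys_iff lookup_homogeneous_part split: if_splits)

lemma homogeneous_part_component:
  "f \<in> polys X \<Longrightarrow> homogeneous_part j f \<in> poly_component X j"
  by (auto simp: poly_component_iff polys_iff keys_homogeneous_part)

lemma homogeneous_part_id: "f \<in> poly_component X j \<Longrightarrow> homogeneous_part j f = f"
  by (rule poly_mapping_eqI) (auto simp: lookup_homogeneous_part poly_component_iff in_keys_iff)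

lemma homogeneous_part_sum:
  "homogeneous_part j (sum f A) = (\<Sum>a\<in>A. homogeneous_part j (f a))"
  by (rule poly_mapping_eqI) (simp add: lookup_homogeneous_part lookup_sum)

lemma homogeneous_part_minus:
  "homogeneous_part j (f - g) = homogeneous_part j f - homogeneous_part j g"
  by (rule poly_mapping_eqI) (simp add: lookup_homogeneous_part lookup_minus)

lemma homogeneous_part_other:
  "f \<in> poly_component X i \<Longrightarrow> i \<noteq> j \<Longrightarrow> homogeneous_part j f = 0"
  by (rule poly_mapping_eqI) (auto simp: lookup_homogeneous_part poly_component_iff in_keys_iff)

lemma homogeneous_decomposition:
  "f = (\<Sum>k\<in>(\<lambda>m. int (monomial_degree m)) ` Poly_Mapping.keys f. homogeneous_part k f)"
proof (rule poly_mapping_eqI)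
  fix m
  show "Poly_Mapping.lookup f m = Poly_Mapping.lookup
     (\<Sum>k\<in>(\<lambda>m. int (monomial_degree m)) ` Poly_Mapping.keys f. homogeneous_part k f) m"
    by (auto simp: lookup_sum lookup_homogeneous_part in_keys_iff image_iff)
qed

text \<open>Only the summand of \<open>f\<close> in degree \<open>j - i\<close> can contribute to degree \<open>j\<close> of \<open>a * f\<close>, as
multiplication by \<open>a\<close> raises every degree by exactly \<open>i\<close>.\<close>

lemma homogeneous_part_mult:
  assumes a: "a \<in> poly_component X i" and f: "f \<in> polys X"
  shows "homogeneous_part j (a * f) = a * homogeneous_part (j - i) f"
proof -
  let ?D = "(\<lambda>m. int (monomial_degree m)) ` Poly_Mapping.keys f"
  have "homogeneous_part j (a * f) = homogeneous_part j (\<Sum>k\<in>?D. a * homogeneous_part k f)"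
    by (subst homogeneous_decomposition[of f]) (simp add: sum_distrib_left)
  also have "\<dots> = (\<Sum>k\<in>?D. homogeneous_part j (a * homogeneous_part k f))"
    by (rule homogeneous_part_sum)
  also have "\<dots> = (\<Sum>k\<in>?D. if k = j - i then a * homogeneous_part k f else 0)"
  proof (rule sum.cong)
    fix k
    have c: "a * homogeneous_part k f \<in> poly_component X (i + k)"
      by (intro component_mult a homogeneous_part_component f)
    then show "homogeneous_part j (a * homogeneous_part k f) =
      (if k = j - i then a * homogeneous_part k f else 0)"
      using homogeneous_part_id[OF c] homogeneous_part_other[OF c, of j] by auto
  qed simp
  also have "\<dots> = (if j - i \<in> ?D then a * homogeneous_part (j - i) f else 0)"
    by simp
  also have "\<dots> = a * homogeneous_part (j - i) f"
  proof -
    have "homogeneous_part (j - i) f = 0" if "j - i \<notin> ?D"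
      using that by (intro poly_mapping_eqI) (auto simp: lookup_homogeneous_part image_iff, metis in_keys_iff)
    then show ?thesis by auto
  qed
  finally show ?thesis .
qed

text \<open>The constant term is multiplicative because exponents cannot cancel: a product of monomials
is \<open>1\<close> only if both factors are. Minimality of a complex is tested with constant terms.\<close>

lemma lookup_mult_0:
  fixes f g :: "('x, 'k::field) mpoly"
  shows "Poly_Mapping.lookup (f * g) 0 = Poly_Mapping.lookup f 0 * Poly_Mapping.lookup g 0"
proof -
  let ?c = "\<lambda>h::('x,'k) mpoly. Poly_Mapping.single 0 (Poly_Mapping.lookup h 0)"
  \<comment> \<open>Each factor is split into its constant term and the rest.\<close>
  have nz: "a + b \<noteq> 0" if "a \<noteq> 0" for a b :: "'x \<Rightarrow>\<^sub>0 nat"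
    using that by (auto simp: poly_mapping_eq_iff fun_eq_iff lookup_add)
  have no0: "Poly_Mapping.lookup (h * h') 0 = 0"
    if "Poly_Mapping.lookup h 0 = 0" for h h' :: "('x,'k) mpoly"
  proof -
    have "0 \<notin> Poly_Mapping.keys (h * h')"
    proof
      assume "0 \<in> Poly_Mapping.keys (h * h')"
      then obtain a b where "a \<in> Poly_Mapping.keys h" "0 = a + b"
        using keys_mult[of h h'] by auto
      moreover have "a \<noteq> 0" using \<open>a \<in> _\<close> that by (auto simp: in_keys_iff)
      ultimately show False using nz by metis
    qed
    then show ?thesis by (simp add: in_keys_iff)
  qed
  have eq: "(f - ?c f) * g + ((g - ?c g) * ?c f + ?c f * ?c g) = f * g"
    by (simp add: algebra_simps)
  have "Poly_Mapping.lookup ((f - ?c f) * g + ((g - ?c g) * ?c f + ?c f * ?c g)) 0 =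
    Poly_Mapping.lookup f 0 * Poly_Mapping.lookup g 0"
    by (simp add: lookup_add no0 lookup_minus mult_single)
  then show ?thesis by (simp only: eq)
qed

text \<open>A homogeneous matrix entry that is a unit modulo the irrelevant ideal connects two basis
elements of the same degree; this is how shifts of different resolutions are compared.\<close>

lemma lookup_nonzero_component:
  assumes "f \<in> poly_component X j" "Poly_Mapping.lookup f 0 \<noteq> 0" shows "j = 0"
  using assms by (auto simp: poly_component_iff in_keys_iff dest!: bspec[of _ _ 0])

section \<open>Homogeneous matrices and lifting of chain maps\<close>

definition free_vecs :: "'x set \<Rightarrow> nat \<Rightarrow> ('x, 'k::field) mpoly vec set" where
  "free_vecs X n = {v \<in> carrier_vec n. set\<^sub>v v \<subseteq> polys X}"

lemma free_vecs_iff: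
  "v \<in> free_vecs X n \<longleftrightarrow> v \<in> carrier_vec n \<and> (\<forall>i<n. v $ i \<in> polys X)"
  by (auto simp: free_vecs_def vec_set_def)

lemma free_vecs_carrier: "v \<in> free_vecs X n \<Longrightarrow> v \<in> carrier_vec n"
  by (simp add: free_vecs_iff)

text \<open>A map of degree \<open>0\<close> from \<open>\<Oplus>S(-s\<^sub>c)\<close> to \<open>\<Oplus>S(-t\<^sub>r)\<close>: the source list comes first, although
its length is the number of columns.\<close>

definition graded_mat ::
    "'x set \<Rightarrow> int list \<Rightarrow> int list \<Rightarrow> ('x, 'k::field) mpoly mat \<Rightarrow> bool" where
  "graded_mat X s t A \<longleftrightarrow> A \<in> carrier_mat (length t) (length s) \<and>
     (\<forall>r<length t. \<forall>c<length s. A $$ (r, c) \<in> poly_component X (s ! c - t ! r))"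

lemma graded_mat_carrier: "graded_mat X s t A \<Longrightarrow> A \<in> carrier_mat (length t) (length s)"
  by (simp add: graded_mat_def)

lemma graded_mat_dim:
  assumes "graded_mat X s t A" shows "dim_row A = length t" "dim_col A = length s"
  using assms by (auto simp: graded_mat_def)

lemma graded_mat_entry:
  "graded_mat X s t A \<Longrightarrow> r < length t \<Longrightarrow> c < length s
     \<Longrightarrow> A $$ (r, c) \<in> poly_component X (s ! c - t ! r)"
  by (simp add: graded_mat_def)

lemma mult_mat_entry:
  assumes "A \<in> carrier_mat n m" "B \<in> carrier_mat m l" "i < n" "j < l"
  shows "(A * B) $$ (i, j) = (\<Sum>k<m. A $$ (i, k) * B $$ (k, j))"
  using assms by (auto simp: scalar_prod_def lessThan_atLeast0 intro!: sum.cong)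

lemma mult_mat_vec_entry:
  assumes "A \<in> carrier_mat n m" "v \<in> carrier_vec m" "i < n"
  shows "(A *\<^sub>v v) $ i = (\<Sum>k<m. A $$ (i, k) * v $ k)"
  using assms by (auto simp: scalar_prod_def lessThan_atLeast0 intro!: sum.cong)

lemma graded_mat_mult:
  assumes A: "graded_mat X s t A" and B: "graded_mat X t u B"
  shows "graded_mat X s u (B * A)"
  unfolding graded_mat_def
proof (intro conjI allI impI)
  note cA = graded_mat_carrier[OF A] and cB = graded_mat_carrier[OF B]
  show "B * A \<in> carrier_mat (length u) (length s)" using cA cB by simp
  fix r c assume rc: "r < length u" "c < length s"
  have "B $$ (r, k) * A $$ (k, c) \<in> poly_component X (s ! c - u ! r)" if "k < length t" for k
    using component_mult[OF graded_mat_entry[OF B rc(1) that] graded_mat_entry[OF A that rc(2)]]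
    by simp
  then show "(B * A) $$ (r, c) \<in> poly_component X (s ! c - u ! r)"
    using rc by (subst mult_mat_entry[OF cB cA]) (auto intro: component_sum)
qed

lemma graded_mat_minus:
  assumes "graded_mat X s t A" "graded_mat X s t B"
  shows "graded_mat X s t (A - B)"
  unfolding graded_mat_def
proof (intro conjI allI impI)
  show "A - B \<in> carrier_mat (length t) (length s)"
    using assms by (auto simp: graded_mat_def)
  fix r c assume rc: "r < length t" "c < length s"
  have "(A - B) $$ (r, c) = A $$ (r, c) - B $$ (r, c)"
    using rc graded_mat_dim[OF assms(2)] by (intro index_minus_mat) simp_all
  then show "(A - B) $$ (r, c) \<in> poly_component X (s ! c - t ! r)"
    using component_minus[OF graded_mat_entry[OF assms(1) rc] graded_mat_entry[OF assms(2) rc]]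
    by simp
qed

lemma graded_mat_one: "graded_mat X s s (1\<^sub>m (length s))"
  by (simp add: graded_mat_def)

lemma graded_mat_uminus:
  assumes "graded_mat X s t A" shows "graded_mat X s t (- A)"
  unfolding graded_mat_def
proof (intro conjI allI impI)
  show "- A \<in> carrier_mat (length t) (length s)"
    using assms by (auto simp: graded_mat_def)
  fix r c assume rc: "r < length t" "c < length s"
  then show "(- A) $$ (r, c) \<in> poly_component X (s ! c - t ! r)"
    using component_uminus[OF graded_mat_entry[OF assms rc]] graded_mat_dim[OF assms] by simp
qed

lemma graded_mat_vec:
  assumes A: "graded_mat X s t A" and v: "v \<in> free_vecs X (length s)"
  shows "A *\<^sub>v v \<in> free_vecs X (length t)"
  unfolding free_vecs_iff
proof (intro conjI allI impI)
  show "A *\<^sub>v v \<in> carrier_vec (length t)"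
    using graded_mat_carrier[OF A] free_vecs_carrier[OF v] by simp
  fix i assume i: "i < length t"
  show "(A *\<^sub>v v) $ i \<in> polys X"
    using v component_polys[OF graded_mat_entry[OF A i]]
    by (subst mult_mat_vec_entry[OF graded_mat_carrier[OF A] free_vecs_carrier[OF v] i])
      (auto intro!: polys_sum polys_mult simp: free_vecs_iff)
qed

lemma graded_mat_col:
  assumes "graded_mat X s t A" "c < length s"
  shows "col A c \<in> free_vecs X (length t)"
  unfolding free_vecs_iff
proof (intro conjI allI impI)
  show "col A c \<in> carrier_vec (length t)"
    using graded_mat_dim[OF assms(1)] by (metis col_dim)
  fix i assume i: "i < length t"
  have "col A c $ i = A $$ (i, c)"
    using assms(2) i graded_mat_dim[OF assms(1)] by simp
  then show "col A c $ i \<in> polys X"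
    using component_polys[OF graded_mat_entry[OF assms(1) i assms(2)]] by simp
qed

lemma col_mult_mat_vec:
  assumes "A \<in> carrier_mat n m" "B \<in> carrier_mat m l" "c < l"
  shows "col (A * B) c = A *\<^sub>v col B c"
  using assms by auto

text \<open>Projectivity of free modules in graded form. A preimage of each column of \<open>N\<close> is chosen, and
its entries are replaced by their homogeneous parts in the degrees that the grading demands;
since \<open>A\<close> and \<open>N\<close> are homogeneous, the result is still a preimage.\<close>

lemma graded_mat_lift:
  assumes A: "graded_mat X s t A" and N: "graded_mat X u t N"
    and im: "\<And>c. c < length u \<Longrightarrow> col N c \<in> (\<lambda>w. A *\<^sub>v w) ` free_vecs X (length s)"
  obtains P where "graded_mat X u s P" "A * P = N"
proof -
  have "\<forall>c. \<exists>w. c < length u \<longrightarrow> w \<in> free_vecs X (length s) \<and> col N c = A *\<^sub>v w"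
    using im by blast
  then obtain w where w: "\<And>c. c < length u \<Longrightarrow> w c \<in> free_vecs X (length s)"
    "\<And>c. c < length u \<Longrightarrow> col N c = A *\<^sub>v w c"
    by metis
  define P where "P = mat (length s) (length u) (\<lambda>(r, c). homogeneous_part (u ! c - s ! r) (w c $ r))"
  have P: "graded_mat X u s P"
    using w(1) by (auto simp: graded_mat_def P_def free_vecs_iff intro!: homogeneous_part_component)
  have "A * P = N"
  proof (rule eq_matI)
    fix r c assume "r < dim_row N" "c < dim_col N"
    then have r: "r < length t" and c: "c < length u" using graded_mat_dim[OF N] by auto
    have "(A * P) $$ (r, c) = (\<Sum>k<length s. A $$ (r, k) * homogeneous_part (u ! c - s ! k) (w c $ k))"
      using c by (subst mult_mat_entry[OF graded_mat_carrier[OF A] graded_mat_carrier[OF P] r c])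
        (simp add: P_def)
    also have "\<dots> = (\<Sum>k<length s. homogeneous_part (u ! c - t ! r) (A $$ (r, k) * w c $ k))"
      using w(1)[OF c]
      by (intro sum.cong refl, subst homogeneous_part_mult[OF graded_mat_entry[OF A r]])
        (auto simp: free_vecs_iff)
    also have "\<dots> = homogeneous_part (u ! c - t ! r) ((A *\<^sub>v w c) $ r)"
      by (subst mult_mat_vec_entry[OF graded_mat_carrier[OF A] free_vecs_carrier[OF w(1)[OF c]] r])
        (simp add: homogeneous_part_sum)
    also have "(A *\<^sub>v w c) $ r = N $$ (r, c)"
      using w(2)[OF c] r c graded_mat_dim[OF N] by (metis index_col)
    also have "homogeneous_part (u ! c - t ! r) \<dots> = N $$ (r, c)"
      by (rule homogeneous_part_id[OF graded_mat_entry[OF N r c]])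
    finally show "(A * P) $$ (r, c) = N $$ (r, c)" .
  qed (use graded_mat_dim[OF N] graded_mat_dim[OF A] graded_mat_dim[OF P] in auto)
  with P show thesis by (rule that)
qed

definition graded_chain ::
    "'x set \<Rightarrow> (nat \<Rightarrow> int list) \<Rightarrow> (nat \<Rightarrow> ('x, 'k::field) mpoly mat) \<Rightarrow> bool" where
  "graded_chain X s D \<longleftrightarrow> (\<forall>i. graded_mat X (s (Suc i)) (s i) (D i)) \<and>
     (\<forall>i. D i * D (Suc i) = 0\<^sub>m (length (s i)) (length (s (Suc (Suc i)))))"

text \<open>Exactness is required at all positions except \<open>0\<close>, where it would involve the resolved
module.\<close>

definition exact_chain ::
    "'x set \<Rightarrow> (nat \<Rightarrow> int list) \<Rightarrow> (nat \<Rightarrow> ('x, 'k::field) mpoly mat) \<Rightarrow> bool" where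
  "exact_chain X s D \<longleftrightarrow> (\<forall>i. graded_mat X (s (Suc i)) (s i) (D i)) \<and>
     (\<forall>i. {v \<in> free_vecs X (length (s (Suc i))). D i *\<^sub>v v = 0\<^sub>v (length (s i))}
       = (\<lambda>w. D (Suc i) *\<^sub>v w) ` free_vecs X (length (s (Suc (Suc i)))))"

lemma graded_chain_mat: "graded_chain X s D \<Longrightarrow> graded_mat X (s (Suc i)) (s i) (D i)"
  by (simp add: graded_chain_def)

lemma exact_chain_mat: "exact_chain X s D \<Longrightarrow> graded_mat X (s (Suc i)) (s i) (D i)"
  by (simp add: exact_chain_def)

lemma exact_chain_im:
  "exact_chain X s D \<Longrightarrow> v \<in> free_vecs X (length (s (Suc i))) \<Longrightarrow> D i *\<^sub>v v = 0\<^sub>v (length (s i))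
    \<Longrightarrow> v \<in> (\<lambda>w. D (Suc i) *\<^sub>v w) ` free_vecs X (length (s (Suc (Suc i))))"
  unfolding exact_chain_def by blast

lemma unit_vec_free_vecs: "unit_vec n c \<in> free_vecs X n"
  by (auto simp: free_vecs_iff unit_vec_def)

lemma mat_mult_unit_vec:
  fixes A :: "'a::comm_ring_1 mat"
  assumes "A \<in> carrier_mat n m" "c < m"
  shows "A *\<^sub>v unit_vec m c = col A c"
  using assms by (intro eq_vecI) auto

lemma exact_chain_graded_chain:
  assumes ex: "exact_chain X s D" shows "graded_chain X s D"
  unfolding graded_chain_def
proof (intro conjI allI)
  show "graded_mat X (s (Suc i)) (s i) (D i)" for i using ex by (rule exact_chain_mat)
  fix i
  note c = graded_mat_carrier[OF exact_chain_mat[OF ex]]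
  show "D i * D (Suc i) = 0\<^sub>m (length (s i)) (length (s (Suc (Suc i))))"
  proof (rule mat_col_eqI)
    fix j assume "j < dim_col (0\<^sub>m (length (s i)) (length (s (Suc (Suc i)))))"
    then have j: "j < length (s (Suc (Suc i)))" by simp
    have "col (D (Suc i)) j = D (Suc i) *\<^sub>v unit_vec (length (s (Suc (Suc i)))) j"
      by (rule mat_mult_unit_vec[OF c j, symmetric])
    then have "col (D (Suc i)) j \<in> (\<lambda>w. D (Suc i) *\<^sub>v w) ` free_vecs X (length (s (Suc (Suc i))))"
      using unit_vec_free_vecs by blast
    then have "D i *\<^sub>v col (D (Suc i)) j = 0\<^sub>v (length (s i))"
      using ex unfolding exact_chain_def by blast
    then show "col (D i * D (Suc i)) j = col (0\<^sub>m (length (s i)) (length (s (Suc (Suc i))))) j"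
      using col_mult_mat_vec[OF c c j] j by auto
  qed (use c in auto)
qed

text \<open>The comparison theorem of homological algebra: into an acyclic complex a chain map can be
extended step by step, because \<open>\<phi>\<^sub>i D\<^sub>i\<close> lands in the kernel of the differential of the target
and hence in the image of the next one. The assumption \<open>start\<close> replaces the condition that
\<open>f\<close> covers a map between the resolved modules.\<close>

lemma chain_map_lift:
  assumes C: "graded_chain X s D" and E: "exact_chain X t E"
    and f: "graded_mat X (s 0) (t 0) f"
    and start: "\<And>c. c < length (s 1) \<Longrightarrow> col (f * D 0) c \<in> (\<lambda>w. E 0 *\<^sub>v w) ` free_vecs X (length (t 1))"
  obtains \<phi> where "\<phi> 0 = f" "\<And>i. graded_mat X (s i) (t i) (\<phi> i)"
    "\<And>i. E i * \<phi> (Suc i) = \<phi> i * D i"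
proof -
  \<comment> \<open>The invariant \<open>P\<close> makes the next lift possible; \<open>Q\<close> links consecutive maps.\<close>
  define P where "P = (\<lambda>i g. graded_mat X (s i) (t i) g \<and> (i = 0 \<longrightarrow> g = f) \<and>
    (\<forall>c<length (s (Suc i)). col (g * D i) c \<in> (\<lambda>w. E i *\<^sub>v w) ` free_vecs X (length (t (Suc i)))))"
  define Q where "Q = (\<lambda>i g h. E i * h = g * D i)"
  note gD = graded_chain_mat[OF C] and gE = exact_chain_mat[OF E]
  have "\<exists>\<phi>. \<forall>i. P i (\<phi> i) \<and> Q i (\<phi> i) (\<phi> (Suc i))"
  proof (rule dependent_nat_choice)
    show "\<exists>g. P 0 g" using f start by (auto simp: P_def)
    fix g i assume g: "P i g"
    then have gg: "graded_mat X (s i) (t i) g" by (simp add: P_def)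
    have "graded_mat X (s (Suc i)) (t i) (g * D i)" by (rule graded_mat_mult[OF gD gg])
    with g obtain h where h: "graded_mat X (s (Suc i)) (t (Suc i)) h" "E i * h = g * D i"
      using graded_mat_lift[OF gE[of i], of "s (Suc i)" "g * D i"] by (auto simp: P_def)
    note c = graded_mat_carrier[OF gD] graded_mat_carrier[OF gE] graded_mat_carrier[OF gg]
      graded_mat_carrier[OF h(1)]
    have gh: "graded_mat X (s (Suc (Suc i))) (t (Suc i)) (h * D (Suc i))"
      by (rule graded_mat_mult[OF gD h(1)])
    have "E i * (h * D (Suc i)) = g * (D i * D (Suc i))"
      using assoc_mult_mat[OF c(2,4) c(1)[of "Suc i"]] assoc_mult_mat[OF c(3) c(1) c(1)[of "Suc i"]]
      by (simp add: h(2))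
    also have "\<dots> = 0\<^sub>m (length (t i)) (length (s (Suc (Suc i))))"
      using C c(3) by (simp add: graded_chain_def)
    finally have z: "E i * (h * D (Suc i)) = 0\<^sub>m (length (t i)) (length (s (Suc (Suc i))))" .
    have "col (h * D (Suc i)) j \<in> (\<lambda>w. E (Suc i) *\<^sub>v w) ` free_vecs X (length (t (Suc (Suc i))))"
      if j: "j < length (s (Suc (Suc i)))" for j
    proof (rule exact_chain_im[OF E graded_mat_col[OF gh j]])
      show "E i *\<^sub>v col (h * D (Suc i)) j = 0\<^sub>v (length (t i))"
        using col_mult_mat_vec[OF c(2) graded_mat_carrier[OF gh] j] z j by simp
    qed
    then have "P (Suc i) h" using h(1) by (simp add: P_def)
    then show "\<exists>h. P (Suc i) h \<and> Q i g h" using h(2) by (auto simp: Q_def)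
  qed
  then obtain \<phi> where \<phi>: "\<And>i. P i (\<phi> i)" "\<And>i. Q i (\<phi> i) (\<phi> (Suc i))" by blast
  show thesis
  proof (rule that)
    show "\<phi> 0 = f" using \<phi>(1)[of 0] unfolding P_def by blast
    show "graded_mat X (s i) (t i) (\<phi> i)" for i using \<phi>(1)[of i] unfolding P_def by blast
    show "E i * \<phi> (Suc i) = \<phi> i * D i" for i using \<phi>(2)[of i] unfolding Q_def .
  qed
qed

section \<open>Shifts of minimal resolutions\<close>

lemma poly_ring_simps [simp]:
  "a \<otimes>\<^bsub>poly_ring X\<^esub> b = a * b" "a \<oplus>\<^bsub>poly_ring X\<^esub> b = a + b"
  "\<one>\<^bsub>poly_ring X\<^esub> = 1" "\<zero>\<^bsub>poly_ring X\<^esub> = 0"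
  by (simp_all add: poly_ring_def)

lemma poly_ring_cring: "cring (poly_ring X)"
proof (rule cringI)
  show "abelian_group (poly_ring X)"
  proof (rule abelian_groupI)
    fix f assume "f \<in> polys X"
    then show "\<exists>g\<in>polys X. g \<oplus>\<^bsub>poly_ring X\<^esub> f = \<zero>\<^bsub>poly_ring X\<^esub>"
      by (intro bexI[of _ "- f"]) (auto intro: polys_uminus)
  qed (auto simp: ac_simps intro: polys_add)
  show "comm_monoid (poly_ring X)"
    by (rule comm_monoidI) (auto simp: ac_simps intro: polys_mult)
qed (auto simp: algebra_simps)

lemma poly_ideal_closed:
  assumes I: "ideal I (poly_ring X)"
  shows ideal_polys: "f \<in> I \<Longrightarrow> f \<in> polys X"
    and ideal_0: "0 \<in> I"
    and ideal_add: "f \<in> I \<Longrightarrow> g \<in> I \<Longrightarrow> f + g \<in> I"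
    and ideal_mult: "f \<in> I \<Longrightarrow> h \<in> polys X \<Longrightarrow> h * f \<in> I"
    and ideal_uminus: "f \<in> I \<Longrightarrow> - f \<in> I"
proof -
  interpret ideal I "poly_ring X" by (rule I)
  show "f \<in> I \<Longrightarrow> f \<in> polys X" by (rule a_Hcarr)
  show "0 \<in> I" using additive_subgroup.zero_closed[OF additive_subgroup_axioms] by simp
  show "f \<in> I \<Longrightarrow> g \<in> I \<Longrightarrow> f + g \<in> I"
    using additive_subgroup.a_closed[OF additive_subgroup_axioms, of f g] by simp
  show mul: "h * f \<in> I" if "f \<in> I" "h \<in> polys X" for f h using I_l_closed[OF that] by simp
  show "f \<in> I \<Longrightarrow> - f \<in> I" using mul[of f "- 1"] by (simp add: polys_uminus)
qed

definition minimal_chain ::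
    "(nat \<Rightarrow> int list) \<Rightarrow> (nat \<Rightarrow> ('x, 'k::field) mpoly mat) \<Rightarrow> bool" where
  "minimal_chain s D \<longleftrightarrow> (\<forall>i. \<forall>r<length (s i). \<forall>c<length (s (Suc i)).
     Poly_Mapping.lookup (D i $$ (r, c)) 0 = 0)"

lemma lookup_mult_mat_0:
  assumes "A \<in> carrier_mat n m" "B \<in> carrier_mat m l" "i < n" "j < l"
    and "(\<forall>k<m. Poly_Mapping.lookup (A $$ (i, k)) 0 = 0) \<or> (\<forall>k<m. Poly_Mapping.lookup (B $$ (k, j)) 0 = 0)"
  shows "Poly_Mapping.lookup ((A * B) $$ (i, j)) (0 :: 'x \<Rightarrow>\<^sub>0 nat) = (0::'k::field)"
  using assms(5) by (subst mult_mat_entry[OF assms(1-4)]) (auto simp: lookup_sum lookup_mult_0)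

text \<open>A chain endomorphism of a minimal resolution that induces zero on the resolved module is null
homotopic, \<open>\<theta>\<^sub>i = D\<^sub>i h\<^sub>i + h\<^sub>i\<^sub>-\<^sub>1 D\<^sub>i\<^sub>-\<^sub>1\<close>. All entries of the differentials lie in the
irrelevant ideal, hence so do those of \<open>\<theta>\<^sub>i\<close>.\<close>

lemma minimal_null_chain_map:
  assumes E: "exact_chain X s D" and min: "minimal_chain s D"
    and th: "\<And>i. graded_mat X (s i) (s i) (\<theta> i)"
    and comm: "\<And>i. D i * \<theta> (Suc i) = \<theta> i * D i"
    and start: "\<And>c. c < length (s 0) \<Longrightarrow> col (\<theta> 0) c \<in> (\<lambda>w. D 0 *\<^sub>v w) ` free_vecs X (length (s 1))"
    and rc: "r < length (s i)" "c < length (s i)"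
  shows "Poly_Mapping.lookup (\<theta> i $$ (r, c)) 0 = 0"
proof -
  note gD = exact_chain_mat[OF E]
  note cD = graded_mat_carrier[OF gD] and ct = graded_mat_carrier[OF th]
  \<comment> \<open>\<open>R i h\<close> is what the homotopy \<open>h\<close> in degree \<open>i\<close> leaves for degree \<open>Suc i\<close> to correct.\<close>
  define R where "R = (\<lambda>i h. \<theta> (Suc i) - h * D i)"
  define P where "P = (\<lambda>i h. graded_mat X (s i) (s (Suc i)) h \<and> (i = 0 \<longrightarrow> D 0 * h = \<theta> 0) \<and>
    (\<forall>c<length (s (Suc i)). col (R i h) c \<in> (\<lambda>w. D (Suc i) *\<^sub>v w) ` free_vecs X (length (s (Suc (Suc i))))))"
  define Q where "Q = (\<lambda>i h h'. D (Suc i) * h' = R i h)"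
  have gR: "graded_mat X (s (Suc i)) (s (Suc i)) (R i h)"
    if "graded_mat X (s i) (s (Suc i)) h" for i h
    unfolding R_def by (intro graded_mat_minus th graded_mat_mult[OF gD that])
  have step: "\<forall>c<length (s (Suc i)). col (R i h) c \<in> (\<lambda>w. D (Suc i) *\<^sub>v w) ` free_vecs X (length (s (Suc (Suc i))))"
    if h: "graded_mat X (s i) (s (Suc i)) h" and z: "(\<theta> i - D i * h) * D i = 0\<^sub>m (length (s i)) (length (s (Suc i)))" for i h
  proof (intro allI impI)
    fix c assume c: "c < length (s (Suc i))"
    note ch = graded_mat_carrier[OF h]
    have "D i * R i h = D i * \<theta> (Suc i) - D i * (h * D i)"
      unfolding R_def by (rule mult_minus_distrib_mat[OF cD ct mult_carrier_mat[OF ch cD]])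
    also have "\<dots> = (\<theta> i - D i * h) * D i"
      using minus_mult_distrib_mat[OF ct mult_carrier_mat[OF cD ch] cD] assoc_mult_mat[OF cD ch cD]
      by (simp add: comm)
    finally have "D i * R i h = 0\<^sub>m (length (s i)) (length (s (Suc i)))" using z by simp
    then have "D i *\<^sub>v col (R i h) c = 0\<^sub>v (length (s i))"
      using col_mult_mat_vec[OF cD graded_mat_carrier[OF gR[OF h]] c] c by simp
    then show "col (R i h) c \<in> (\<lambda>w. D (Suc i) *\<^sub>v w) ` free_vecs X (length (s (Suc (Suc i))))"
      by (intro exact_chain_im[OF E graded_mat_col[OF gR[OF h] c]])
  qed
  have "\<exists>h. \<forall>i. P i (h i) \<and> Q i (h i) (h (Suc i))"
  proof (rule dependent_nat_choice)
    obtain h where h: "graded_mat X (s 0) (s 1) h" "D 0 * h = \<theta> 0"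
      using graded_mat_lift[OF gD[of 0] th[of 0]] start by auto
    have "(\<theta> 0 - D 0 * h) * D 0 = 0\<^sub>m (length (s 0)) (length (s (Suc 0)))"
      using ct[of 0] cD[of 0] h(2) by (simp add: minus_r_inv_mat)
    with step[of 0 h] h have "P 0 h" by (auto simp: P_def)
    then show "\<exists>h. P 0 h" by blast
    fix h i assume Ph: "P i h"
    then have h: "graded_mat X (s i) (s (Suc i)) h" by (simp add: P_def)
    note ch = graded_mat_carrier[OF h]
    obtain h' where h': "graded_mat X (s (Suc i)) (s (Suc (Suc i))) h'" "D (Suc i) * h' = R i h"
      using graded_mat_lift[OF gD[of "Suc i"] gR[OF h]] Ph by (auto simp: P_def)
    have "\<theta> (Suc i) - D (Suc i) * h' = h * D i"
      unfolding h'(2) R_def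
      using ct[of "Suc i"] mult_carrier_mat[OF ch cD] by (intro eq_matI) auto
    then have "(\<theta> (Suc i) - D (Suc i) * h') * D (Suc i) = h * (D i * D (Suc i))"
      using assoc_mult_mat[OF ch cD cD] by simp
    also have "\<dots> = 0\<^sub>m (length (s (Suc i))) (length (s (Suc (Suc i))))"
      using exact_chain_graded_chain[OF E] ch by (simp add: graded_chain_def)
    finally have "P (Suc i) h'" using step[OF h'(1)] h'(1) by (simp add: P_def)
    then show "\<exists>h'. P (Suc i) h' \<and> Q i h h'" using h'(2) by (auto simp: Q_def)
  qed
  then obtain h where PQ: "\<And>i. P i (h i)" "\<And>i. Q i (h i) (h (Suc i))" by blast
  have h: "\<And>i. graded_mat X (s i) (s (Suc i)) (h i)" "D 0 * h 0 = \<theta> 0"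
    "\<And>i. D (Suc i) * h (Suc i) = \<theta> (Suc i) - h i * D i"
    using PQ(1) PQ(1)[of 0] PQ(2) unfolding P_def Q_def R_def by blast+
  note ch = graded_mat_carrier[OF h(1)]
  have D0: "Poly_Mapping.lookup ((D i * h i) $$ (r, c)) 0 = 0"
    using min by (intro lookup_mult_mat_0[OF cD ch rc]) (use rc in \<open>auto simp: minimal_chain_def\<close>)
  show ?thesis
  proof (cases i)
    case 0
    then show ?thesis using D0 h(2) by simp
  next
    case (Suc j)
    have h0: "Poly_Mapping.lookup ((h j * D j) $$ (r, c)) 0 = 0"
      using min Suc rc by (intro lookup_mult_mat_0[OF ch cD]) (auto simp: minimal_chain_def)
    have "(D i * h i) $$ (r, c) = \<theta> i $$ (r, c) - (h j * D j) $$ (r, c)"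
      unfolding Suc h(3) using rc Suc carrier_matD[OF mult_carrier_mat[OF ch[of j] cD[of j]]]
      by (subst index_minus_mat) auto
    then show ?thesis using D0 h0 by (simp add: lookup_minus)
  qed
qed

definition homogeneous_closed :: "('x, 'k::field) mpoly set \<Rightarrow> bool" where
  "homogeneous_closed I \<longleftrightarrow> (\<forall>f\<in>I. \<forall>j. homogeneous_part j f \<in> I)"

lemma vec_1_eqI: "v \<in> carrier_vec 1 \<Longrightarrow> w \<in> carrier_vec 1 \<Longrightarrow> v $ 0 = w $ 0 \<Longrightarrow> v = w"
  by (intro eq_vecI) auto

text \<open>Every resolution contains the minimal one as a direct summand, which is why its shifts bound
those of the minimal one. Concretely, lift the identity of \<open>S/I\<close> to chain maps \<open>\<phi>\<close> from the
minimal complex \<open>D\<close> to \<open>E\<close> and \<open>\<psi>\<close> back. Then \<open>\<psi>\<phi>\<close> is the identity modulo the irrelevant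
ideal, so the diagonal entry of \<open>\<psi>\<^sub>i\<phi>\<^sub>i\<close> at a basis element of degree \<open>j\<close> has constant term
\<open>1\<close>, and one of its summands passes through a basis element of \<open>E\<close> of the same degree.

The row \<open>g\<close> lists representatives of the images in \<open>S/I\<close> of the generators of the minimal
complex; the complex \<open>E\<close> starts with \<open>S\<close> itself, generated by the class of \<open>1\<close>.\<close>

lemma minimal_resolution_shifts:
  assumes I: "ideal I (poly_ring X)" and hI: "homogeneous_closed I"
    and F: "exact_chain X s D" and min: "minimal_chain s D"
    and g: "graded_mat X (s 0) [0] g"
    and surj: "\<exists>v\<in>free_vecs X (length (s 0)). (g *\<^sub>v v) $ 0 - 1 \<in> I"
    and kerF: "{v \<in> free_vecs X (length (s 0)). (g *\<^sub>v v) $ 0 \<in> I}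
       = (\<lambda>w. D 0 *\<^sub>v w) ` free_vecs X (length (s 1))"
    and G: "exact_chain X t E" and t0: "t 0 = [0]"
    and kerG: "{v \<in> free_vecs X 1. v $ 0 \<in> I} = (\<lambda>w. E 0 *\<^sub>v w) ` free_vecs X (length (t 1))"
  shows "set (s i) \<subseteq> set (t i)"
proof -
  note gD = exact_chain_mat[OF F] and gE = exact_chain_mat[OF G]
  note cD = graded_mat_carrier[OF gD] and cE = graded_mat_carrier[OF gE]
  have cg: "g \<in> carrier_mat 1 (length (s 0))" using graded_mat_carrier[OF g] by simp
  have gp: "g $$ (0, k) \<in> poly_component X (s 0 ! k)" if "k < length (s 0)" for k
    using graded_mat_entry[OF g, of 0 k] that by simp
  obtain v where v: "v \<in> free_vecs X (length (s 0))" "(g *\<^sub>v v) $ 0 - 1 \<in> I" using surj by blast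
  \<comment> \<open>A homogeneous preimage of the class of \<open>1\<close>; it starts the lift from \<open>E\<close> to \<open>D\<close>.\<close>
  define \<psi>0 where "\<psi>0 = mat (length (s 0)) 1 (\<lambda>(k, c). homogeneous_part (- (s 0 ! k)) (v $ k))"
  have p0: "graded_mat X (t 0) (s 0) \<psi>0"
    using v(1) by (auto simp: graded_mat_def t0 \<psi>0_def free_vecs_iff intro!: homogeneous_part_component)
  have cp0: "\<psi>0 \<in> carrier_mat (length (s 0)) 1" by (simp add: \<psi>0_def)
  have unit: "(g * \<psi>0) $$ (0, 0) - 1 \<in> I"
  proof -
    have "(g * \<psi>0) $$ (0, 0) = (\<Sum>k<length (s 0). g $$ (0, k) * homogeneous_part (- (s 0 ! k)) (v $ k))"
      by (subst mult_mat_entry[OF cg cp0]) (auto simp: \<psi>0_def)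
    also have "\<dots> = (\<Sum>k<length (s 0). homogeneous_part 0 (g $$ (0, k) * v $ k))"
      using v(1) by (intro sum.cong refl, subst homogeneous_part_mult[OF gp]) (auto simp: free_vecs_iff)
    also have "\<dots> = homogeneous_part 0 ((g *\<^sub>v v) $ 0)"
      by (subst mult_mat_vec_entry[OF cg free_vecs_carrier[OF v(1)]]) (simp_all add: homogeneous_part_sum)
    finally have "(g * \<psi>0) $$ (0, 0) - 1 = homogeneous_part 0 ((g *\<^sub>v v) $ 0 - 1)"
      by (simp add: homogeneous_part_minus homogeneous_part_id[OF component_1])
    then show ?thesis using v(2) hI by (simp add: homogeneous_closed_def)
  qed
  obtain \<phi> where \<phi>: "\<phi> 0 = g" "\<And>i. graded_mat X (s i) (t i) (\<phi> i)"
    "\<And>i. E i * \<phi> (Suc i) = \<phi> i * D i"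
  proof (rule chain_map_lift[OF exact_chain_graded_chain[OF F] G, of g])
    show "graded_mat X (s 0) (t 0) g" using g t0 by simp
    fix c assume c: "c < length (s 1)"
    have "D 0 *\<^sub>v unit_vec (length (s 1)) c \<in> (\<lambda>w. D 0 *\<^sub>v w) ` free_vecs X (length (s 1))"
      using unit_vec_free_vecs by blast
    then have d: "col (D 0) c \<in> free_vecs X (length (s 0))" "(g *\<^sub>v col (D 0) c) $ 0 \<in> I"
      using mat_mult_unit_vec[of "D 0" _ _ c] cD[of 0] c unfolding kerF[symmetric] by auto
    have "col (g * D 0) c \<in> {v \<in> free_vecs X 1. v $ 0 \<in> I}"
      using d(2) graded_mat_vec[OF g d(1)] col_mult_mat_vec[OF cg cD[of 0, simplified]] c by auto
    then show "col (g * D 0) c \<in> (\<lambda>w. E 0 *\<^sub>v w) ` free_vecs X (length (t 1))"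
      unfolding kerG .
  qed blast
  obtain \<psi> where \<psi>: "\<psi> 0 = \<psi>0" "\<And>i. graded_mat X (t i) (s i) (\<psi> i)"
    "\<And>i. D i * \<psi> (Suc i) = \<psi> i * E i"
  proof (rule chain_map_lift[OF exact_chain_graded_chain[OF G] F p0])
    fix c assume c: "c < length (t 1)"
    have cE0: "E 0 \<in> carrier_mat 1 (length (t 1))" using cE[of 0] t0 by simp
    have "E 0 *\<^sub>v unit_vec (length (t 1)) c \<in> (\<lambda>w. E 0 *\<^sub>v w) ` free_vecs X (length (t 1))"
      using unit_vec_free_vecs by blast
    then have e: "E 0 $$ (0, c) \<in> I"
      using mat_mult_unit_vec[OF cE0 c] cE0 c unfolding kerG[symmetric] by auto
    have "(g * (\<psi>0 * E 0)) $$ (0, c) = (g * \<psi>0) $$ (0, 0) * E 0 $$ (0, c)"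
      using c by (subst assoc_mult_mat[OF cg cp0 cE0, symmetric], subst mult_mat_entry[OF _ cE0])
        (use cg cp0 in auto)
    also have "\<dots> = E 0 $$ (0, c) * ((g * \<psi>0) $$ (0, 0) - 1) + E 0 $$ (0, c)"
      by (simp add: algebra_simps)
    also have "\<dots> \<in> I"
      by (intro ideal_add[OF I] e ideal_mult[OF I unit] ideal_polys[OF I e])
    finally have "(g *\<^sub>v col (\<psi>0 * E 0) c) $ 0 \<in> I"
      using cg cp0 cE0 c by (simp del: assoc_mult_mat)
    moreover have "col (\<psi>0 * E 0) c \<in> free_vecs X (length (s 0))"
      using graded_mat_col[OF graded_mat_mult[OF gE[of 0] p0]] c by simp
    ultimately show "col (\<psi>0 * E 0) c \<in> (\<lambda>w. D 0 *\<^sub>v w) ` free_vecs X (length (s 1))"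
      using kerF by blast
  qed blast
  note cf = graded_mat_carrier[OF \<phi>(2)] and cp = graded_mat_carrier[OF \<psi>(2)]
  define \<theta> where "\<theta> i = \<psi> i * \<phi> i - 1\<^sub>m (length (s i))" for i
  have th: "graded_mat X (s i) (s i) (\<theta> i)" for i
    unfolding \<theta>_def by (intro graded_mat_minus graded_mat_one graded_mat_mult[OF \<phi>(2) \<psi>(2)])
  have zero: "Poly_Mapping.lookup (\<theta> i $$ (r, c)) 0 = 0" if "r < length (s i)" "c < length (s i)" for r c
  proof (rule minimal_null_chain_map[OF F min th _ _ that])
    fix i
    have "D i * \<theta> (Suc i) = D i * (\<psi> (Suc i) * \<phi> (Suc i)) - D i * 1\<^sub>m (length (s (Suc i)))"
      unfolding \<theta>_def by (rule mult_minus_distrib_mat[OF cD mult_carrier_mat[OF cp cf] one_carrier_mat])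
    also have "D i * (\<psi> (Suc i) * \<phi> (Suc i)) = \<psi> i * (E i * \<phi> (Suc i))"
      using assoc_mult_mat[OF cD cp cf] assoc_mult_mat[OF cp cE cf] \<psi>(3) by metis
    also have "\<dots> = (\<psi> i * \<phi> i) * D i"
      using assoc_mult_mat[OF cp cf cD] \<phi>(3) by simp
    also have "D i * 1\<^sub>m (length (s (Suc i))) = 1\<^sub>m (length (s i)) * D i" using cD[of i] by simp
    also have "\<psi> i * \<phi> i * D i - 1\<^sub>m (length (s i)) * D i = \<theta> i * D i"
      unfolding \<theta>_def by (rule minus_mult_distrib_mat[OF mult_carrier_mat[OF cp cf] one_carrier_mat cD, symmetric])
    finally show "D i * \<theta> (Suc i) = \<theta> i * D i" .
  next
    fix c assume c: "c < length (s 0)"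
    have "g * \<theta> 0 = g * (\<psi>0 * g) - g * 1\<^sub>m (length (s 0))"
      unfolding \<theta>_def \<psi>(1) \<phi>(1)
      by (rule mult_minus_distrib_mat[OF cg mult_carrier_mat[OF cp0 cg] one_carrier_mat])
    also have "g * (\<psi>0 * g) = (g * \<psi>0) * g" by (rule assoc_mult_mat[OF cg cp0 cg, symmetric])
    finally have "(g * \<theta> 0) $$ (0, c) = ((g * \<psi>0) * g) $$ (0, c) - g $$ (0, c)"
      using cg cp0 c by simp
    also have "((g * \<psi>0) * g) $$ (0, c) = (g * \<psi>0) $$ (0, 0) * g $$ (0, c)"
      using c by (subst mult_mat_entry[OF _ cg]) (use cg cp0 in auto)
    also have "(g * \<psi>0) $$ (0, 0) * g $$ (0, c) - g $$ (0, c) = g $$ (0, c) * ((g * \<psi>0) $$ (0, 0) - 1)"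
      by (simp add: algebra_simps)
    also have "\<dots> \<in> I" by (intro ideal_mult[OF I unit] component_polys[OF gp] c)
    finally have "(g *\<^sub>v col (\<theta> 0) c) $ 0 \<in> I"
      using cg c graded_mat_dim[OF th[of 0]] by simp
    then show "col (\<theta> 0) c \<in> (\<lambda>w. D 0 *\<^sub>v w) ` free_vecs X (length (s 1))"
      using graded_mat_col[OF th c] kerF by blast
  qed
  show ?thesis
  proof
    fix j assume "j \<in> set (s i)"
    then obtain c where c: "c < length (s i)" "s i ! c = j" by (auto simp: in_set_conv_nth)
    have "\<theta> i $$ (c, c) = (\<Sum>k<length (t i). \<psi> i $$ (c, k) * \<phi> i $$ (k, c)) - 1"
      unfolding \<theta>_def using c(1) mult_mat_entry[OF cp cf c(1) c(1)] cp[of i] cf[of i] by simp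
    with zero[OF c(1) c(1)] have "(\<Sum>k<length (t i). Poly_Mapping.lookup (\<psi> i $$ (c, k)) 0 *
        Poly_Mapping.lookup (\<phi> i $$ (k, c)) 0) = 1"
      by (simp add: lookup_minus lookup_sum lookup_mult_0)
    moreover have "(\<Sum>k<length (t i). Poly_Mapping.lookup (\<psi> i $$ (c, k)) 0 *
        Poly_Mapping.lookup (\<phi> i $$ (k, c)) 0) = 0"
      if "\<forall>k<length (t i). Poly_Mapping.lookup (\<phi> i $$ (k, c)) 0 = 0"
      using that by (intro sum.neutral) simp
    ultimately obtain k where k: "k < length (t i)" "Poly_Mapping.lookup (\<phi> i $$ (k, c)) 0 \<noteq> 0"
      by (metis zero_neq_one)
    then have "s i ! c - t i ! k = 0"
      by (intro lookup_nonzero_component[OF graded_mat_entry[OF \<phi>(2)]]) (use c in auto)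
    with c k(1) show "j \<in> set (t i)" by (metis eq_iff_diff_eq_0 nth_mem)
  qed
qed

section \<open>The mapping cone\<close>

text \<open>A minimal resolution of \<open>S/I\<close> for an ideal \<open>I\<close> whose first module is \<open>S\<close> itself, so that the
augmentation can be expressed by membership in \<open>I\<close>.\<close>

definition minimal_ideal_resolution ::
    "'x set \<Rightarrow> ('x, 'k::field) mpoly set \<Rightarrow> (nat \<Rightarrow> int list) \<Rightarrow> (nat \<Rightarrow> ('x, 'k) mpoly mat) \<Rightarrow> bool" where
  "minimal_ideal_resolution X I t E \<longleftrightarrow> t 0 = [0] \<and> exact_chain X t E \<and> minimal_chain t E \<and>
     {v \<in> free_vecs X 1. v $ 0 \<in> I} = (\<lambda>w. E 0 *\<^sub>v w) ` free_vecs X (length (t 1))"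

lemma graded_mat_shift:
  "graded_mat X s t A \<Longrightarrow> graded_mat X (map (\<lambda>j. j + e) s) (map (\<lambda>j. j + e) t) A"
  by (simp add: graded_mat_def)

lemma graded_mat_smult:
  assumes A: "graded_mat X s t A" and u: "u \<in> poly_component X e"
  shows "graded_mat X (map (\<lambda>j. j + e) s) t (u \<cdot>\<^sub>m A)"
  unfolding graded_mat_def
proof (intro conjI allI impI)
  show "u \<cdot>\<^sub>m A \<in> carrier_mat (length t) (length (map (\<lambda>j. j + e) s))"
    using A by (simp add: graded_mat_def)
  fix r c assume r: "r < length t" and "c < length (map (\<lambda>j. j + e) s)"
  then have c: "c < length s" by simp
  have eq: "e + (s ! c - t ! r) = map (\<lambda>j. j + e) s ! c - t ! r" using c by simp
  have "(u \<cdot>\<^sub>m A) $$ (r, c) = u * A $$ (r, c)"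
    using r c graded_mat_dim[OF A] by simp
  then show "(u \<cdot>\<^sub>m A) $$ (r, c) \<in> poly_component X (map (\<lambda>j. j + e) s ! c - t ! r)"
    using component_mult[OF u graded_mat_entry[OF A r c]] by (simp only: eq)
qed

lemma graded_mat_four_block:
  assumes A: "graded_mat X s t A" and B: "graded_mat X s' t B"
    and C: "graded_mat X s t' C" and D: "graded_mat X s' t' D"
  shows "graded_mat X (s @ s') (t @ t') (four_block_mat A B C D)"
  unfolding graded_mat_def
proof (intro conjI allI impI)
  note d = graded_mat_dim[OF A] graded_mat_dim[OF B] graded_mat_dim[OF C] graded_mat_dim[OF D]
  show "four_block_mat A B C D \<in> carrier_mat (length (t @ t')) (length (s @ s'))"
    using d by (intro carrier_matI) simp_all
  fix r c assume r: "r < length (t @ t')" and c: "c < length (s @ s')"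
  have eq: "four_block_mat A B C D $$ (r, c) = (if r < length t
      then if c < length s then A $$ (r, c) else B $$ (r, c - length s)
      else if c < length s then C $$ (r - length t, c) else D $$ (r - length t, c - length s))"
    using r c d by simp
  have 1: "r - length t < length t'" if "\<not> r < length t" using r that by simp
  have 2: "c - length s < length s'" if "\<not> c < length s" using c that by simp
  show "four_block_mat A B C D $$ (r, c) \<in> poly_component X ((s @ s') ! c - (t @ t') ! r)"
    unfolding eq nth_append
    using graded_mat_entry[OF A] graded_mat_entry[OF B _ 2]
      graded_mat_entry[OF C 1] graded_mat_entry[OF D 1 2]
    by auto
qed

lemma graded_mat_zero: "graded_mat X s t (0\<^sub>m (length t) (length s))"
  by (simp add: graded_mat_def)

lemma free_vecs_add: "v \<in> free_vecs X n \<Longrightarrow> w \<in> free_vecs X n \<Longrightarrow> v + w \<in> free_vecs X n"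
  by (auto simp: free_vecs_iff polys_add)

lemma free_vecs_uminus: "v \<in> free_vecs X n \<Longrightarrow> - v \<in> free_vecs X n"
  by (auto simp: free_vecs_iff polys_uminus)

lemma free_vecs_append:
  "v \<in> free_vecs X (a + b) \<longleftrightarrow> (\<exists>x\<in>free_vecs X a. \<exists>y\<in>free_vecs X b. v = x @\<^sub>v y)"
proof
  assume v: "v \<in> free_vecs X (a + b)"
  have "v = vec_first v a @\<^sub>v vec_last v b"
    using v by (simp add: free_vecs_iff)
  moreover have "vec_first v a \<in> free_vecs X a" "vec_last v b \<in> free_vecs X b"
    using v by (auto simp: free_vecs_iff vec_first_def vec_last_def)
  ultimately show "\<exists>x\<in>free_vecs X a. \<exists>y\<in>free_vecs X b. v = x @\<^sub>v y" by blast
next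
  assume "\<exists>x\<in>free_vecs X a. \<exists>y\<in>free_vecs X b. v = x @\<^sub>v y"
  then show "v \<in> free_vecs X (a + b)"
    by (auto simp: free_vecs_iff index_append_vec)
qed

lemma free_vecs_appendI:
  "x \<in> free_vecs X a \<Longrightarrow> y \<in> free_vecs X b \<Longrightarrow> x @\<^sub>v y \<in> free_vecs X (a + b)"
  using free_vecs_append by blast

lemma zero_mat_mult_vec:
  "v \<in> carrier_vec m \<Longrightarrow> 0\<^sub>m n m *\<^sub>v v = (0\<^sub>v n :: 'a::semiring_1 vec)"
  by (intro eq_vecI) auto

lemma component_lookup_0: "f \<in> poly_component X e \<Longrightarrow> e \<noteq> 0 \<Longrightarrow> Poly_Mapping.lookup f 0 = 0"
  using lookup_nonzero_component by blast

lemma mult_mat_vec_uminus: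
  fixes A :: "'a::comm_ring_1 mat"
  assumes "A \<in> carrier_mat n m" "v \<in> carrier_vec m"
  shows "A *\<^sub>v (- v) = - (A *\<^sub>v v)"
  using assms by (intro eq_vecI) auto

lemma uminus_mult_mat_vec_uminus:
  fixes A :: "'a::comm_ring_1 mat"
  assumes "A \<in> carrier_mat n m" "v \<in> carrier_vec m"
  shows "- A *\<^sub>v (- v) = A *\<^sub>v v"
  using assms by (intro eq_vecI) auto

text \<open>Multiplication by \<open>um\<close> gives the exact sequence
\<open>0 \<rightarrow> S/(J : um)(-e-1) \<rightarrow> S/J \<rightarrow> S/(J + (um)) \<rightarrow> 0\<close>, and the cone over a lift of its first map
resolves the last module. In general this cone is not minimal. Here \<open>J : um\<close> equals
\<open>J : m = L\<close>, so the lift can be chosen as \<open>u\<close> times a lift \<open>\<psi>\<close> of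
\<open>m : S/L(-e) \<rightarrow> S/J\<close>, and all its entries lie in the irrelevant ideal. The cone is therefore
minimal as soon as the two given resolutions are.\<close>

lemma mapping_cone:
  fixes u m :: "('x, 'k::field) mpoly"
  assumes J: "ideal J (poly_ring X)"
    and A: "minimal_ideal_resolution X L s D" and B: "minimal_ideal_resolution X J t E"
    and m: "m \<in> poly_component X e" and u: "u \<in> poly_component X 1"
    and LJ: "\<And>a. a \<in> L \<Longrightarrow> m * a \<in> J"
    and colon: "\<And>a. a \<in> polys X \<Longrightarrow> u * m * a \<in> J \<Longrightarrow> a \<in> L"
    and J': "\<And>f. f \<in> J' \<longleftrightarrow> (\<exists>g\<in>J. \<exists>a\<in>polys X. f = g + u * m * a)"
  shows "\<exists>C. minimal_ideal_resolution X J'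
     (\<lambda>i. t i @ (case i of 0 \<Rightarrow> [] | Suc k \<Rightarrow> map (\<lambda>j. j + (e + 1)) (s k))) C"
proof -
  have s0: "s 0 = [0]" and AE: "exact_chain X s D" and Amin: "minimal_chain s D"
    and AL: "{v \<in> free_vecs X 1. v $ 0 \<in> L} = (\<lambda>w. D 0 *\<^sub>v w) ` free_vecs X (length (s 1))"
    using A by (auto simp: minimal_ideal_resolution_def)
  have t0: "t 0 = [0]" and BE: "exact_chain X t E" and Bmin: "minimal_chain t E"
    and BJ: "{v \<in> free_vecs X 1. v $ 0 \<in> J} = (\<lambda>w. E 0 *\<^sub>v w) ` free_vecs X (length (t 1))"
    using B by (auto simp: minimal_ideal_resolution_def)
  note gD = exact_chain_mat[OF AE] and gE = exact_chain_mat[OF BE]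
  note cD = graded_mat_carrier[OF gD] and cE = graded_mat_carrier[OF gE]
  have DD: "D i * D (Suc i) = 0\<^sub>m (length (s i)) (length (s (Suc (Suc i))))" for i
    using exact_chain_graded_chain[OF AE] by (simp add: graded_chain_def)
  have EE: "E i * E (Suc i) = 0\<^sub>m (length (t i)) (length (t (Suc (Suc i))))" for i
    using exact_chain_graded_chain[OF BE] by (simp add: graded_chain_def)
  \<comment> \<open>The resolution of \<open>S/L\<close> with degrees raised by \<open>e\<close>, so that \<open>\<psi>\<close> has degree \<open>0\<close>.\<close>
  define s' where "s' i = map (\<lambda>j. j + e) (s i)" for i
  have C': "graded_chain X s' D"
    using graded_mat_shift[OF gD] DD by (simp add: graded_chain_def s'_def)
  define \<psi>0 where "\<psi>0 = mat 1 1 (\<lambda>_. m)"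
  have p0: "graded_mat X (s' 0) (t 0) \<psi>0"
    using m by (simp add: graded_mat_def \<psi>0_def s'_def s0 t0)
  obtain \<psi> where \<psi>: "\<psi> 0 = \<psi>0" "\<And>i. graded_mat X (s' i) (t i) (\<psi> i)"
    "\<And>i. E i * \<psi> (Suc i) = \<psi> i * D i"
  proof (rule chain_map_lift[OF C' BE p0])
    fix c assume "c < length (s' 1)"
    then have c: "c < length (s 1)" by (simp add: s'_def)
    have cD0: "D 0 \<in> carrier_mat 1 (length (s 1))" using cD[of 0] s0 by simp
    have cp0: "\<psi>0 \<in> carrier_mat 1 1" by (simp add: \<psi>0_def)
    have "D 0 *\<^sub>v unit_vec (length (s 1)) c \<in> (\<lambda>w. D 0 *\<^sub>v w) ` free_vecs X (length (s 1))"
      using unit_vec_free_vecs by blast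
    then have e: "D 0 $$ (0, c) \<in> L"
      using mat_mult_unit_vec[OF cD0 c] cD0 c unfolding AL[symmetric] by auto
    have "(\<psi>0 * D 0) $$ (0, c) = m * D 0 $$ (0, c)"
      by (subst mult_mat_entry[OF cp0 cD0 _ c]) (auto simp: \<psi>0_def)
    then have "col (\<psi>0 * D 0) c \<in> {v \<in> free_vecs X 1. v $ 0 \<in> J}"
      using LJ[OF e] cp0 cD0 c graded_mat_col[OF graded_mat_mult[OF graded_chain_mat[OF C', of 0] p0]]
      by (simp add: s'_def t0)
    then show "col (\<psi>0 * D 0) c \<in> (\<lambda>w. E 0 *\<^sub>v w) ` free_vecs X (length (t 1))"
      unfolding BJ .
  qed blast
  define U where "U i = u \<cdot>\<^sub>m \<psi> i" for i
  \<comment> \<open>The same resolution moved up by one homological degree and one internal degree, with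
    zero in position \<open>0\<close> and negated differentials: the second summand of the cone.\<close>
  define sA where "sA i = (case i of 0 \<Rightarrow> [] | Suc k \<Rightarrow> map (\<lambda>j. j + (e + 1)) (s k))" for i
  define dA where "dA i = (case i of 0 \<Rightarrow> 0\<^sub>m 0 (length (s 0)) | Suc k \<Rightarrow> - D k)" for i
  have sA_Suc: "length (sA (Suc i)) = length (s i)" for i by (simp add: sA_def)
  have gU: "graded_mat X (sA (Suc i)) (t i) (U i)" for i
    using graded_mat_smult[OF \<psi>(2) u] by (simp add: U_def sA_def s'_def comp_def add.assoc)
  have cU: "U i \<in> carrier_mat (length (t i)) (length (s i))" for i
    using graded_mat_carrier[OF gU] by (simp add: sA_Suc)
  have gA: "graded_mat X (sA (Suc i)) (sA i) (dA i)" for i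
  proof (cases i)
    case 0
    then show ?thesis using graded_mat_zero[of X "sA (Suc 0)" "[]"] by (simp add: sA_def dA_def)
  next
    case (Suc k)
    then show ?thesis
      using graded_mat_uminus[OF graded_mat_shift[OF gD]] by (simp add: sA_def dA_def)
  qed
  have cA: "dA i \<in> carrier_mat (length (sA i)) (length (s i))" for i
    using graded_mat_carrier[OF gA] by (simp add: sA_Suc)
  have cpsi: "\<psi> i \<in> carrier_mat (length (t i)) (length (s i))" for i
    using graded_mat_carrier[OF \<psi>(2)] by (simp add: s'_def)
  have EU: "E i * U (Suc i) = U i * D i" for i
    using mult_smult_distrib[OF cE cpsi] mult_smult_assoc_mat[OF cpsi cD] by (simp add: U_def \<psi>(3))
  define C where "C i = four_block_mat (E i) (U i) (0\<^sub>m (length (sA i)) (length (t (Suc i)))) (dA i)" for i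
  have gC: "graded_mat X (t (Suc i) @ sA (Suc i)) (t i @ sA i) (C i)" for i
    unfolding C_def by (intro graded_mat_four_block gE gU gA graded_mat_zero)
  have Cv: "C i *\<^sub>v (x @\<^sub>v y) = (E i *\<^sub>v x + U i *\<^sub>v y) @\<^sub>v (dA i *\<^sub>v y)"
    if x: "x \<in> free_vecs X (length (t (Suc i)))" and y: "y \<in> free_vecs X (length (s i))" for i x y
  proof -
    note cx = free_vecs_carrier[OF x] and cy = free_vecs_carrier[OF y]
    have "C i *\<^sub>v (x @\<^sub>v y) = (E i *\<^sub>v x + U i *\<^sub>v y) @\<^sub>v
       (0\<^sub>m (length (sA i)) (length (t (Suc i))) *\<^sub>v x + dA i *\<^sub>v y)"
      unfolding C_def by (rule four_block_mat_mult_vec[OF cE cU _ cA cx cy]) simp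
    also have "0\<^sub>m (length (sA i)) (length (t (Suc i))) *\<^sub>v x = 0\<^sub>v (length (sA i))"
      by (rule zero_mat_mult_vec[OF cx])
    also have "0\<^sub>v (length (sA i)) + dA i *\<^sub>v y = dA i *\<^sub>v y"
      using cA[of i] cy by simp
    finally show ?thesis .
  qed
  have EUv: "E i *\<^sub>v (U (Suc i) *\<^sub>v y) = U i *\<^sub>v (D i *\<^sub>v y)"
    if y: "y \<in> free_vecs X (length (s (Suc i)))" for i y
    using assoc_mult_mat_vec[OF cE cU free_vecs_carrier[OF y]]
      assoc_mult_mat_vec[OF cU cD free_vecs_carrier[OF y]] EU by simp
  have Uf: "U i *\<^sub>v y \<in> free_vecs X (length (t i))" if "y \<in> free_vecs X (length (s i))" for i y
    using graded_mat_vec[OF gU[of i]] that by (simp add: sA_Suc)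
  have U0: "(U 0 *\<^sub>v y) $ 0 = u * m * y $ 0" if y: "y \<in> free_vecs X 1" for y
  proof -
    have "U 0 \<in> carrier_mat 1 1" using cU[of 0] by (simp add: s0 t0)
    from mult_mat_vec_entry[OF this free_vecs_carrier[OF y]] show ?thesis
      by (simp add: U_def \<psi>(1) \<psi>0_def mult.assoc)
  qed
  have len: "length (t i @ sA (Suc j)) = length (t i) + length (s j)" for i j
    by (simp add: sA_Suc)
  have exact: "{v \<in> free_vecs X (length (t (Suc i) @ sA (Suc i))). C i *\<^sub>v v = 0\<^sub>v (length (t i @ sA i))}
    = (\<lambda>w. C (Suc i) *\<^sub>v w) ` free_vecs X (length (t (Suc (Suc i)) @ sA (Suc (Suc i))))" for i
  proof (intro equalityI subsetI)
    fix v assume "v \<in> (\<lambda>w. C (Suc i) *\<^sub>v w) ` free_vecs X (length (t (Suc (Suc i)) @ sA (Suc (Suc i))))"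
    then obtain x y where x: "x \<in> free_vecs X (length (t (Suc (Suc i))))"
      and y: "y \<in> free_vecs X (length (s (Suc i)))" and v: "v = C (Suc i) *\<^sub>v (x @\<^sub>v y)"
      by (auto simp: sA_Suc free_vecs_append)
    note cx = free_vecs_carrier[OF x] and cy = free_vecs_carrier[OF y]
    define x' where "x' = E (Suc i) *\<^sub>v x + U (Suc i) *\<^sub>v y"
    define y' where "y' = - (D i *\<^sub>v y)"
    have x': "x' \<in> free_vecs X (length (t (Suc i)))"
      unfolding x'_def by (intro free_vecs_add Uf graded_mat_vec[OF gE] x y)
    have Dy: "D i *\<^sub>v y \<in> free_vecs X (length (s i))" by (rule graded_mat_vec[OF gD y])
    have y': "y' \<in> free_vecs X (length (s i))"
      unfolding y'_def by (intro free_vecs_uminus Dy)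
    have "dA (Suc i) *\<^sub>v y = y'"
      using cD[of i] cy by (simp add: dA_def y'_def)
    then have v': "v = x' @\<^sub>v y'" using v Cv[OF x y] by (simp add: x'_def)
    have "E i *\<^sub>v x' = E i *\<^sub>v (E (Suc i) *\<^sub>v x) + E i *\<^sub>v (U (Suc i) *\<^sub>v y)"
      unfolding x'_def
      by (rule mult_add_distrib_mat_vec[OF cE mult_mat_vec_carrier[OF cE cx] mult_mat_vec_carrier[OF cU cy]])
    also have "E i *\<^sub>v (E (Suc i) *\<^sub>v x) = 0\<^sub>v (length (t i))"
      using assoc_mult_mat_vec[OF cE cE cx] EE[of i] zero_mat_mult_vec[OF cx] by simp
    also have "E i *\<^sub>v (U (Suc i) *\<^sub>v y) = - (U i *\<^sub>v y')"
      using EUv[OF y] mult_mat_vec_uminus[OF cU free_vecs_carrier[OF Dy]] by (simp add: y'_def)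
    finally have 1: "E i *\<^sub>v x' + U i *\<^sub>v y' = 0\<^sub>v (length (t i))"
      using cU[of i] free_vecs_carrier[OF y'] by simp
    have 2: "dA i *\<^sub>v y' = 0\<^sub>v (length (sA i))"
    proof (cases i)
      case 0
      then show ?thesis using cA[of i] by (intro eq_vecI) (auto simp: sA_def dA_def)
    next
      case (Suc k)
      have "D k *\<^sub>v (D i *\<^sub>v y) = 0\<^sub>v (length (s k))"
        using assoc_mult_mat_vec[OF cD[of k] cD[of "Suc k"], of y] DD[of k] cy
          zero_mat_mult_vec[of y "length (s (Suc (Suc k)))"] Suc by simp
      moreover have "dA i *\<^sub>v y' = D k *\<^sub>v (D i *\<^sub>v y)"
        unfolding Suc dA_def y'_def nat.case
        by (rule uminus_mult_mat_vec_uminus[OF cD free_vecs_carrier[OF Dy[unfolded Suc]]])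
      ultimately show ?thesis by (simp add: Suc sA_Suc)
    qed
    have "C i *\<^sub>v v = 0\<^sub>v (length (t i)) @\<^sub>v 0\<^sub>v (length (sA i))"
      unfolding v' Cv[OF x' y'] 1 2 ..
    also have "\<dots> = 0\<^sub>v (length (t i @ sA i))" by (intro eq_vecI) auto
    finally show "v \<in> {v \<in> free_vecs X (length (t (Suc i) @ sA (Suc i))). C i *\<^sub>v v = 0\<^sub>v (length (t i @ sA i))}"
      using x' y' v' unfolding len free_vecs_append by blast
  next
    fix v assume "v \<in> {v \<in> free_vecs X (length (t (Suc i) @ sA (Suc i))). C i *\<^sub>v v = 0\<^sub>v (length (t i @ sA i))}"
    then obtain x y where x: "x \<in> free_vecs X (length (t (Suc i)))"
      and y: "y \<in> free_vecs X (length (s i))" and v: "v = x @\<^sub>v y"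
      and "C i *\<^sub>v v = 0\<^sub>v (length (t i @ sA i))"
      unfolding len free_vecs_append by blast
    note cx = free_vecs_carrier[OF x] and cy = free_vecs_carrier[OF y]
    have "(E i *\<^sub>v x + U i *\<^sub>v y) @\<^sub>v (dA i *\<^sub>v y) = 0\<^sub>v (length (t i)) @\<^sub>v 0\<^sub>v (length (sA i))"
      using \<open>C i *\<^sub>v v = _\<close> unfolding v Cv[OF x y] by (simp, intro eq_vecI) auto
    then have eq: "E i *\<^sub>v x + U i *\<^sub>v y = 0\<^sub>v (length (t i))" "dA i *\<^sub>v y = 0\<^sub>v (length (sA i))"
      using cE[of i] cU[of i] cx cy by (auto simp: append_vec_eq[of _ "length (t i)"])
    have cEx: "E i *\<^sub>v x \<in> carrier_vec (length (t i))" and cUy: "U i *\<^sub>v y \<in> carrier_vec (length (t i))"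
      using cE[of i] cU[of i] cx cy by auto
    \<comment> \<open>In position \<open>0\<close> the cycle condition on \<open>y\<close> comes from the colon ideal and not from a
      differential.\<close>
    have "\<exists>z\<in>free_vecs X (length (s (Suc i))). y = D i *\<^sub>v z"
    proof (cases i)
      case 0
      have y1: "y \<in> free_vecs X 1" using y 0 s0 by simp
      have "E 0 *\<^sub>v x \<in> (\<lambda>w. E 0 *\<^sub>v w) ` free_vecs X (length (t 1))" using x 0 by simp
      then have "(E 0 *\<^sub>v x) $ 0 \<in> J" unfolding BJ[symmetric] by blast
      moreover have "(U 0 *\<^sub>v y) $ 0 = - (E 0 *\<^sub>v x) $ 0"
        using eq(1) cEx cUy 0 t0 by (auto simp: vec_eq_iff eq_neg_iff_add_eq_0 add.commute)
      ultimately have "u * m * y $ 0 \<in> J" using ideal_uminus[OF J] U0[OF y1] by simp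
      then have "y $ 0 \<in> L" using colon y1 by (auto simp: free_vecs_iff)
      then have "y \<in> (\<lambda>w. D 0 *\<^sub>v w) ` free_vecs X (length (s 1))"
        using y1 unfolding AL[symmetric] by blast
      then show ?thesis using 0 by auto
    next
      case (Suc k)
      have "- (D k *\<^sub>v y) = 0\<^sub>v (length (s k))"
        using eq(2) Suc cy cD[of k] by (simp add: dA_def sA_Suc)
      then have "D k *\<^sub>v y = 0\<^sub>v (length (s k))"
        by (metis uminus_uminus_vec uminus_zero_vec)
      then show ?thesis using exact_chain_im[OF AE, of y k] y Suc by auto
    qed
    then obtain z where z: "z \<in> free_vecs X (length (s (Suc i)))" "y = D i *\<^sub>v z" by blast
    note cz = free_vecs_carrier[OF z(1)]
    have cUz: "U (Suc i) *\<^sub>v z \<in> carrier_vec (length (t (Suc i)))" by (rule mult_mat_vec_carrier[OF cU cz])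
    have "E i *\<^sub>v (x + U (Suc i) *\<^sub>v z) = E i *\<^sub>v x + E i *\<^sub>v (U (Suc i) *\<^sub>v z)"
      by (rule mult_add_distrib_mat_vec[OF cE cx cUz])
    also have "\<dots> = 0\<^sub>v (length (t i))" using EUv[OF z(1)] z(2) eq(1) by simp
    finally obtain w where w: "w \<in> free_vecs X (length (t (Suc (Suc i))))"
      "x + U (Suc i) *\<^sub>v z = E (Suc i) *\<^sub>v w"
      using exact_chain_im[OF BE free_vecs_add[OF x Uf[OF z(1)]]] by blast
    have mz: "- z \<in> free_vecs X (length (s (Suc i)))" by (rule free_vecs_uminus[OF z(1)])
    have "E (Suc i) *\<^sub>v w + U (Suc i) *\<^sub>v (- z) = x"
      unfolding w(2)[symmetric] mult_mat_vec_uminus[OF cU cz]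
      using cx cUz by (intro eq_vecI) auto
    moreover have "dA (Suc i) *\<^sub>v (- z) = y"
      unfolding dA_def nat.case z(2) by (rule uminus_mult_mat_vec_uminus[OF cD cz])
    ultimately have "v = C (Suc i) *\<^sub>v (w @\<^sub>v - z)" using Cv[OF w(1) mz] v by simp
    then show "v \<in> (\<lambda>w. C (Suc i) *\<^sub>v w) ` free_vecs X (length (t (Suc (Suc i)) @ sA (Suc (Suc i))))"
      using free_vecs_appendI[OF w(1) mz] unfolding len by blast
  qed
  have image: "{v \<in> free_vecs X 1. v $ 0 \<in> J'} = (\<lambda>w. C 0 *\<^sub>v w) ` free_vecs X (length (t 1 @ sA 1))"
  proof -
    have C0: "C 0 *\<^sub>v (x @\<^sub>v y) = E 0 *\<^sub>v x + U 0 *\<^sub>v y"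
      if "x \<in> free_vecs X (length (t 1))" "y \<in> free_vecs X 1" for x y
    proof -
      have "dim_vec (dA 0 *\<^sub>v y) = 0" by (simp add: dA_def)
      then show ?thesis using Cv[of x 0 y] that by (simp add: s0, intro eq_vecI) auto
    qed
    have EU0: "E 0 *\<^sub>v x + U 0 *\<^sub>v y \<in> free_vecs X 1"
      "(E 0 *\<^sub>v x + U 0 *\<^sub>v y) $ 0 = (E 0 *\<^sub>v x) $ 0 + u * m * y $ 0"
      if "x \<in> free_vecs X (length (t 1))" "y \<in> free_vecs X 1" for x y
    proof -
      have f: "E 0 *\<^sub>v x \<in> free_vecs X 1" "U 0 *\<^sub>v y \<in> free_vecs X 1"
        using graded_mat_vec[OF gE[of 0], of x] Uf[of y 0] that by (simp_all add: s0 t0)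
      then show "E 0 *\<^sub>v x + U 0 *\<^sub>v y \<in> free_vecs X 1" by (rule free_vecs_add)
      have "(E 0 *\<^sub>v x + U 0 *\<^sub>v y) $ 0 = (E 0 *\<^sub>v x) $ 0 + (U 0 *\<^sub>v y) $ 0"
        using carrier_vecD[OF free_vecs_carrier[OF f(2)]] by (intro index_add_vec) simp
      then show "(E 0 *\<^sub>v x + U 0 *\<^sub>v y) $ 0 = (E 0 *\<^sub>v x) $ 0 + u * m * y $ 0"
        unfolding U0[OF that(2)] .
    qed
    have len1: "length (t 1 @ sA 1) = length (t 1) + 1" using len[of 1 0] s0 by simp
    show ?thesis
    proof (intro equalityI subsetI)
      fix v assume "v \<in> {v \<in> free_vecs X 1. v $ 0 \<in> J'}"
      then have v: "v \<in> free_vecs X 1" "v $ 0 \<in> J'" by auto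
      then obtain g a where ga: "g \<in> J" "a \<in> polys X" "v $ 0 = g + u * m * a" using J' by blast
      define y where "y = vec 1 (\<lambda>_. a)"
      have y: "y \<in> free_vecs X 1" using ga by (simp add: y_def free_vecs_iff)
      have "vec 1 (\<lambda>_. g) \<in> {v \<in> free_vecs X 1. v $ 0 \<in> J}"
        using ga(1) ideal_polys[OF J] by (simp add: free_vecs_iff)
      then obtain x where x: "x \<in> free_vecs X (length (t 1))" "vec 1 (\<lambda>_. g) = E 0 *\<^sub>v x"
        unfolding BJ by blast
      have "(E 0 *\<^sub>v x) $ 0 = g" unfolding x(2)[symmetric] by simp
      then have "v $ 0 = (E 0 *\<^sub>v x + U 0 *\<^sub>v y) $ 0"
        unfolding EU0(2)[OF x(1) y] ga(3) by (simp add: y_def)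
      then have "v = C 0 *\<^sub>v (x @\<^sub>v y)"
        unfolding C0[OF x(1) y] by (rule vec_1_eqI[OF free_vecs_carrier[OF v(1)] free_vecs_carrier[OF EU0(1)[OF x(1) y]]])
      then show "v \<in> (\<lambda>w. C 0 *\<^sub>v w) ` free_vecs X (length (t 1 @ sA 1))"
        using free_vecs_appendI[OF x(1) y] unfolding len1 by blast
    next
      fix v assume "v \<in> (\<lambda>w. C 0 *\<^sub>v w) ` free_vecs X (length (t 1 @ sA 1))"
      then obtain x y where x: "x \<in> free_vecs X (length (t 1))" and y: "y \<in> free_vecs X 1"
        and v: "v = C 0 *\<^sub>v (x @\<^sub>v y)"
        unfolding len1 by (auto simp: free_vecs_append simp del: add_Suc_right One_nat_def)
      have "E 0 *\<^sub>v x \<in> {v \<in> free_vecs X 1. v $ 0 \<in> J}" using x unfolding BJ by blast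
      moreover have "y $ 0 \<in> polys X" using y by (simp add: free_vecs_iff)
      ultimately have "v $ 0 \<in> J'" unfolding v C0[OF x y] EU0(2)[OF x y] J' by blast
      then show "v \<in> {v \<in> free_vecs X 1. v $ 0 \<in> J'}"
        using EU0(1)[OF x y] v C0[OF x y] by simp
    qed
  qed
  have min: "minimal_chain (\<lambda>i. t i @ sA i) C"
    unfolding minimal_chain_def
  proof (intro allI impI)
    fix i r c assume r: "r < length (t i @ sA i)" and c: "c < length (t (Suc i) @ sA (Suc i))"
    note d = carrier_matD[OF cE[of i]] carrier_matD[OF cU[of i]] carrier_matD[OF cA[of i]]
    have u0: "Poly_Mapping.lookup u 0 = 0" by (rule component_lookup_0[OF u]) simp
    have 1: "Poly_Mapping.lookup (E i $$ (r, c)) 0 = 0" if "r < length (t i)" "c < length (t (Suc i))"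
      using Bmin that by (simp add: minimal_chain_def)
    have 2: "Poly_Mapping.lookup (U i $$ (r, c)) 0 = 0" if "r < length (t i)" "c < length (s i)" for c
      using that carrier_matD[OF cpsi[of i]] by (simp add: U_def lookup_mult_0 u0)
    have 3: "Poly_Mapping.lookup (dA i $$ (r, c)) 0 = 0" if "r < length (sA i)" "c < length (s i)" for r c
    proof (cases i)
      case (Suc k)
      then show ?thesis
        using that Amin carrier_matD[OF cD[of k]] by (simp add: dA_def sA_Suc minimal_chain_def)
    qed (use that in \<open>simp add: sA_def\<close>)
    show "Poly_Mapping.lookup (C i $$ (r, c)) 0 = 0"
      unfolding C_def using r c d 1 2[of "c - length (t (Suc i))"]
        3[of "r - length (t i)" "c - length (t (Suc i))"] by (auto simp: sA_Suc)
  qed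
  have "minimal_ideal_resolution X J' (\<lambda>i. t i @ sA i) C"
    unfolding minimal_ideal_resolution_def exact_chain_def
    using gC exact image min by (simp add: t0 sA_def)
  then show ?thesis unfolding sA_def by blast
qed

section \<open>Squarefree monomial ideals\<close>

lemma lookup_single_mult:
  fixes g :: "('x, 'k::field) mpoly"
  shows "Poly_Mapping.lookup (Poly_Mapping.single a c * g) (a + m) = c * Poly_Mapping.lookup g m"
  by (simp add: lookup_mult lookup_single when_mult)

lemma keys_single_mult:
  fixes g :: "('x, 'k::field) mpoly"
  shows "Poly_Mapping.keys (Poly_Mapping.single a 1 * g) = (+) a ` Poly_Mapping.keys g"
proof
  show "Poly_Mapping.keys (Poly_Mapping.single a 1 * g) \<subseteq> (+) a ` Poly_Mapping.keys g"
    using keys_mult[of "Poly_Mapping.single a 1" g] by auto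
  show "(+) a ` Poly_Mapping.keys g \<subseteq> Poly_Mapping.keys (Poly_Mapping.single a 1 * g)"
    by (auto simp: in_keys_iff lookup_single_mult)
qed

lemma poly_mapping_sum_single:
  fixes f :: "'a \<Rightarrow>\<^sub>0 'b::comm_monoid_add"
  shows "f = (\<Sum>m\<in>Poly_Mapping.keys f. Poly_Mapping.single m (Poly_Mapping.lookup f m))"
proof (rule poly_mapping_eqI)
  fix k
  show "Poly_Mapping.lookup f k = Poly_Mapping.lookup
     (\<Sum>m\<in>Poly_Mapping.keys f. Poly_Mapping.single m (Poly_Mapping.lookup f m)) k"
    by (auto simp: lookup_sum lookup_single when_def in_keys_iff)
qed

definition squarefree_exponent :: "'x set \<Rightarrow> 'x \<Rightarrow>\<^sub>0 nat" where
  "squarefree_exponent A = (\<Sum>x\<in>A. Poly_Mapping.single x 1)"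

definition squarefree_monomial :: "'x set \<Rightarrow> ('x, 'k::field) mpoly" where
  "squarefree_monomial A = Poly_Mapping.single (squarefree_exponent A) 1"

lemma lookup_squarefree_exponent:
  "finite A \<Longrightarrow> Poly_Mapping.lookup (squarefree_exponent A) x = (if x \<in> A then 1 else 0)"
  by (simp add: squarefree_exponent_def lookup_sum lookup_single when_def)

lemma keys_squarefree_exponent: "finite A \<Longrightarrow> Poly_Mapping.keys (squarefree_exponent A) = A"
  by (auto simp: in_keys_iff lookup_squarefree_exponent split: if_splits)

lemma squarefree_monomial_singleton: "squarefree_monomial {x} = variable x"
  by (simp add: squarefree_monomial_def squarefree_exponent_def variable_def)

lemma squarefree_monomial_Un:
  "finite A \<Longrightarrow> finite B \<Longrightarrow> A \<inter> B = {} \<Longrightarrow>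
    squarefree_monomial A * squarefree_monomial B = squarefree_monomial (A \<union> B)"
  by (simp add: squarefree_monomial_def squarefree_exponent_def mult_single sum.union_disjoint)

lemma squarefree_monomial_component:
  assumes "finite A" "A \<subseteq> X" shows "squarefree_monomial A \<in> poly_component X (int (card A))"
proof -
  have "monomial_degree (squarefree_exponent A) = card A"
    using assms by (simp add: monomial_degree_def keys_squarefree_exponent lookup_squarefree_exponent)
  then show ?thesis
    using assms by (simp add: poly_component_iff polys_iff squarefree_monomial_def keys_squarefree_exponent)
qed

text \<open>The ideal generated by the squarefree monomials with supports in \<open>\<E>\<close>. A polynomial lies in a
monomial ideal iff each of its monomials does; describing the ideal in this way reduces colon
ideals and sums to statements about sets of variables.\<close>

definition squarefree_ideal :: "'x set \<Rightarrow> 'x set set \<Rightarrow> ('x, 'k::field) mpoly set" where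
  "squarefree_ideal X \<E> =
     {f \<in> polys X. \<forall>m\<in>Poly_Mapping.keys f. \<exists>e\<in>\<E>. e \<subseteq> Poly_Mapping.keys m}"

lemma squarefree_ideal_iff:
  "f \<in> squarefree_ideal X \<E> \<longleftrightarrow> f \<in> polys X \<and>
     (\<forall>m\<in>Poly_Mapping.keys f. \<exists>e\<in>\<E>. e \<subseteq> Poly_Mapping.keys m)"
  by (simp add: squarefree_ideal_def)

lemma squarefree_ideal_add:
  "f \<in> squarefree_ideal X \<E> \<Longrightarrow> g \<in> squarefree_ideal X \<E> \<Longrightarrow> f + g \<in> squarefree_ideal X \<E>"
  using keys_add[of f g] by (auto simp: squarefree_ideal_iff intro: polys_add)

lemma squarefree_ideal_mult:
  assumes f: "f \<in> squarefree_ideal X \<E>" and h: "h \<in> polys X"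
  shows "h * f \<in> squarefree_ideal X \<E>"
  unfolding squarefree_ideal_iff
proof (intro conjI ballI)
  show "h * f \<in> polys X" using f h by (auto simp: squarefree_ideal_iff intro: polys_mult)
  fix m assume "m \<in> Poly_Mapping.keys (h * f)"
  then obtain a b where m: "m = a + b" "b \<in> Poly_Mapping.keys f" using keys_mult[of h f] by auto
  then obtain e where "e \<in> \<E>" "e \<subseteq> Poly_Mapping.keys b" using f by (auto simp: squarefree_ideal_iff)
  then show "\<exists>e\<in>\<E>. e \<subseteq> Poly_Mapping.keys m" using m(1) by (auto simp: keys_exponent_add)
qed

lemma squarefree_ideal_ideal: "ideal (squarefree_ideal X \<E>) (poly_ring X)"
proof (rule idealI)
  interpret cring "poly_ring X" by (rule poly_ring_cring)
  show "ring (poly_ring X)" by (rule ring_axioms)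
  show "subgroup (squarefree_ideal X \<E>) (add_monoid (poly_ring X))"
  proof (rule add.subgroupI)
    fix f assume f: "f \<in> squarefree_ideal X \<E>"
    then have "f \<oplus>\<^bsub>poly_ring X\<^esub> - f = \<zero>\<^bsub>poly_ring X\<^esub>" "f \<in> polys X" "- f \<in> polys X"
      by (auto simp: squarefree_ideal_iff polys_uminus)
    then have "\<ominus>\<^bsub>poly_ring X\<^esub> f = - f" using minus_equality by (metis a_comm)
    moreover have "- f \<in> squarefree_ideal X \<E>"
      using squarefree_ideal_mult[OF f, of "- 1"] by (simp add: polys_uminus)
    ultimately show "\<ominus>\<^bsub>poly_ring X\<^esub> f \<in> squarefree_ideal X \<E>" by simp
  next
    have "0 \<in> squarefree_ideal X \<E>" by (simp add: squarefree_ideal_iff)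
    then show "squarefree_ideal X \<E> \<noteq> {}" by blast
  next
    show "squarefree_ideal X \<E> \<subseteq> polys X" by (auto simp: squarefree_ideal_iff)
  qed (simp add: squarefree_ideal_add)
  show "a \<in> squarefree_ideal X \<E> \<Longrightarrow> x \<in> polys X \<Longrightarrow> x \<otimes>\<^bsub>poly_ring X\<^esub> a \<in> squarefree_ideal X \<E>"
    "a \<in> squarefree_ideal X \<E> \<Longrightarrow> x \<in> polys X \<Longrightarrow> a \<otimes>\<^bsub>poly_ring X\<^esub> x \<in> squarefree_ideal X \<E>"
    for a x
    using squarefree_ideal_mult[of a X \<E> x] by (simp_all add: mult.commute)
qed

lemma squarefree_ideal_homogeneous: "homogeneous_closed (squarefree_ideal X \<E>)"
  by (auto simp: homogeneous_closed_def squarefree_ideal_iff keys_homogeneous_part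
      intro: component_polys[OF homogeneous_part_component])

text \<open>Multiplication by the monomial adds \<open>A\<close> to the support of every exponent, and
\<open>e \<subseteq> A \<union> K\<close> iff \<open>e - A \<subseteq> K\<close>.\<close>

lemma squarefree_ideal_colon:
  assumes A: "finite A" "A \<subseteq> X" and f: "f \<in> polys X"
  shows "squarefree_monomial A * f \<in> squarefree_ideal X \<E>
    \<longleftrightarrow> f \<in> squarefree_ideal X ((\<lambda>e. e - A) ` \<E>)"
proof -
  have "squarefree_monomial A * f \<in> polys X"
    by (intro polys_mult f component_polys[OF squarefree_monomial_component[OF A]])
  moreover have "e \<subseteq> A \<union> K \<longleftrightarrow> e - A \<subseteq> K" for e K by blast
  ultimately show ?thesis
    using f A by (simp add: squarefree_ideal_iff squarefree_monomial_def keys_single_mult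
        keys_exponent_add keys_squarefree_exponent)
qed

text \<open>Generators that are divisible by another generator can be dropped or added.\<close>

lemma squarefree_ideal_absorb:
  assumes "\<And>e. e \<in> \<A> \<Longrightarrow> \<exists>e'\<in>\<B>. e' \<subseteq> e" and "\<And>e. e \<in> \<B> \<Longrightarrow> \<exists>e'\<in>\<A>. e' \<subseteq> e"
  shows "squarefree_ideal X \<A> = squarefree_ideal X \<B>"
proof -
  have "(\<exists>e\<in>\<A>. e \<subseteq> K) \<longleftrightarrow> (\<exists>e\<in>\<B>. e \<subseteq> K)" for K using assms by (meson order_trans)
  then show ?thesis by (simp add: squarefree_ideal_def)
qed

lemma squarefree_monomial_dvd:
  assumes A: "finite A" and f: "f \<in> polys X" "\<And>m. m \<in> Poly_Mapping.keys f \<Longrightarrow> A \<subseteq> Poly_Mapping.keys m"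
  shows "\<exists>a\<in>polys X. f = squarefree_monomial A * a"
proof -
  define q where "q m = m - squarefree_exponent A" for m :: "'a \<Rightarrow>\<^sub>0 nat"
  have q: "m = squarefree_exponent A + q m" if "m \<in> Poly_Mapping.keys f" for m
    using f(2)[OF that]
    by (intro poly_mapping_eqI)
      (auto simp: q_def lookup_add lookup_minus lookup_squarefree_exponent[OF A] in_keys_iff subset_iff Suc_le_eq)
  define a where "a = (\<Sum>m\<in>Poly_Mapping.keys f. Poly_Mapping.single (q m) (Poly_Mapping.lookup f m))"
  have "a \<in> polys X"
    unfolding a_def
  proof (rule polys_sum)
    fix m assume m: "m \<in> Poly_Mapping.keys f"
    have "Poly_Mapping.keys (q m) \<subseteq> Poly_Mapping.keys m"
      using arg_cong[OF q[OF m], of Poly_Mapping.keys] by (auto simp: keys_exponent_add)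
    also have "\<dots> \<subseteq> X" using f(1) m by (simp add: polys_iff)
    finally show "Poly_Mapping.single (q m) (Poly_Mapping.lookup f m) \<in> polys X"
      by (simp add: polys_iff)
  qed
  moreover have "f = squarefree_monomial A * a"
    unfolding a_def sum_distrib_left squarefree_monomial_def mult_single
    by (subst poly_mapping_sum_single) (auto simp: q[symmetric] intro!: sum.cong)
  ultimately show ?thesis by blast
qed

lemma squarefree_ideal_insert:
  fixes f :: "('x, 'k::field) mpoly"
  assumes A: "finite A" "A \<subseteq> X"
  shows "f \<in> squarefree_ideal X (insert A \<E>) \<longleftrightarrow>
    (\<exists>g\<in>squarefree_ideal X \<E>. \<exists>a\<in>polys X. f = g + squarefree_monomial A * a)"
proof
  assume f: "f \<in> squarefree_ideal X (insert A \<E>)"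
  define P where "P m \<longleftrightarrow> A \<subseteq> Poly_Mapping.keys m" for m :: "'x \<Rightarrow>\<^sub>0 nat"
  define part where "part Q = (\<Sum>m\<in>{m \<in> Poly_Mapping.keys f. Q m}.
    Poly_Mapping.single m (Poly_Mapping.lookup f m))" for Q
  have keys_part: "Poly_Mapping.keys (part Q) \<subseteq> {m \<in> Poly_Mapping.keys f. Q m}" for Q
    by (auto simp: part_def in_keys_iff lookup_sum lookup_single when_def split: if_splits)
  have part_polys: "part Q \<in> polys X" for Q
    using keys_part[of Q] f by (auto simp: squarefree_ideal_iff polys_iff)
  have un: "{m \<in> Poly_Mapping.keys f. \<not> P m} \<union> {m \<in> Poly_Mapping.keys f. P m} = Poly_Mapping.keys f"
    by blast
  have "part (\<lambda>m. \<not> P m) + part P = (\<Sum>m\<in>{m \<in> Poly_Mapping.keys f. \<not> P m} \<union>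
      {m \<in> Poly_Mapping.keys f. P m}. Poly_Mapping.single m (Poly_Mapping.lookup f m))"
    unfolding part_def by (rule sum.union_disjoint[symmetric]) auto
  then have "f = part (\<lambda>m. \<not> P m) + part P"
    unfolding un poly_mapping_sum_single[symmetric] by simp
  moreover have "part (\<lambda>m. \<not> P m) \<in> squarefree_ideal X \<E>"
    using f keys_part[of "\<lambda>m. \<not> P m"] part_polys by (fastforce simp: squarefree_ideal_iff P_def)
  moreover obtain a where "a \<in> polys X" "part P = squarefree_monomial A * a"
    using squarefree_monomial_dvd[OF A(1) part_polys[of P]] keys_part[of P] by (auto simp: P_def)
  ultimately show "\<exists>g\<in>squarefree_ideal X \<E>. \<exists>a\<in>polys X. f = g + squarefree_monomial A * a"
    by metis
next
  assume "\<exists>g\<in>squarefree_ideal X \<E>. \<exists>a\<in>polys X. f = g + squarefree_monomial A * a"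
  then obtain g a where g: "g \<in> squarefree_ideal X \<E>" and a: "a \<in> polys X"
    and f: "f = g + squarefree_monomial A * a" by blast
  have "squarefree_monomial A * a \<in> squarefree_ideal X (insert A \<E>)"
    unfolding squarefree_ideal_colon[OF A a] using a by (auto simp: squarefree_ideal_iff)
  moreover have "g \<in> squarefree_ideal X (insert A \<E>)"
    using g by (auto simp: squarefree_ideal_iff)
  ultimately show "f \<in> squarefree_ideal X (insert A \<E>)"
    unfolding f by (intro squarefree_ideal_add)
qed

text \<open>The conclusion that is carried through the induction on forests: besides the bound on the
regularity it contains the existence of a finite minimal resolution. The type argument fixes
the field.\<close>

definition regularity_at_most :: "'k::field itself \<Rightarrow> 'x set \<Rightarrow> 'x set set \<Rightarrow> int \<Rightarrow> bool" where
  "regularity_at_most K X \<E> r \<longleftrightarrow> (\<exists>t E N.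
     minimal_ideal_resolution X (squarefree_ideal X \<E> :: ('x, 'k) mpoly set) t E \<and>
     (\<forall>i\<ge>N. t i = []) \<and> (\<forall>i. \<forall>j\<in>set (t i). j - int i \<le> r))"

lemma regularity_at_most_cong:
  fixes K :: "'k::field itself" and X :: "'x set"
  assumes "\<And>e. e \<in> \<A> \<Longrightarrow> \<exists>e'\<in>\<B>. e' \<subseteq> e" and "\<And>e. e \<in> \<B> \<Longrightarrow> \<exists>e'\<in>\<A>. e' \<subseteq> e"
  shows "regularity_at_most K X \<A> r \<longleftrightarrow> regularity_at_most K X \<B> r"
proof -
  have "(squarefree_ideal X \<A> :: ('x, 'k) mpoly set) = squarefree_ideal X \<B>"
    using assms by (rule squarefree_ideal_absorb)
  then show ?thesis unfolding regularity_at_most_def by simp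
qed

text \<open>The mapping cone for a new generator \<open>A\<close> with a variable \<open>u\<close> that no other generator contains:
the colon ideal by the new monomial is then the colon ideal by the monomial without \<open>u\<close>. The
colon part moves up by one homological degree and by \<open>card A\<close> internal degrees, so it may
contribute at most \<open>r + 1 - card A\<close>.\<close>

lemma regularity_at_most_insert:
  fixes K :: "'k::field itself" and X :: "'x set"
  assumes A: "finite A" "A \<subseteq> X" and u: "u \<in> A" "u \<notin> \<Union>\<E>"
    and colon: "regularity_at_most K X ((\<lambda>e. e - (A - {u})) ` \<E>) (r + 1 - int (card A))"
    and base: "regularity_at_most K X \<E> r"
  shows "regularity_at_most K X (insert A \<E>) r"
proof -
  let ?I = "\<lambda>\<E>. squarefree_ideal X \<E> :: ('x, 'k) mpoly set"
  obtain s D M where s: "minimal_ideal_resolution X (?I ((\<lambda>e. e - (A - {u})) ` \<E>)) s D"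
    "\<forall>i\<ge>M. s i = []" "\<forall>i. \<forall>j\<in>set (s i). j - int i \<le> r + 1 - int (card A)"
    using colon unfolding regularity_at_most_def by blast
  obtain t E N where t: "minimal_ideal_resolution X (?I \<E>) t E"
    "\<forall>i\<ge>N. t i = []" "\<forall>i. \<forall>j\<in>set (t i). j - int i \<le> r"
    using base unfolding regularity_at_most_def by blast
  let ?m = "squarefree_monomial (A - {u}) :: ('x, 'k) mpoly"
  let ?u = "squarefree_monomial {u} :: ('x, 'k) mpoly"
  let ?e = "int (card (A - {u}))"
  have e: "?e + 1 = int (card A)" using card_Suc_Diff1[OF A(1) u(1)] by linarith
  have um: "?u * ?m = squarefree_monomial A"
    using squarefree_monomial_Un[of "{u}" "A - {u}"] A(1) u(1) by (simp add: insert_absorb)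
  have mX: "?m \<in> poly_component X ?e" using A by (intro squarefree_monomial_component) auto
  have "\<exists>C. minimal_ideal_resolution X (?I (insert A \<E>))
     (\<lambda>i. t i @ (case i of 0 \<Rightarrow> [] | Suc k \<Rightarrow> map (\<lambda>j. j + (?e + 1)) (s k))) C"
  proof (rule mapping_cone[OF squarefree_ideal_ideal s(1) t(1) mX])
    show "?u \<in> poly_component X 1"
      using squarefree_monomial_component[of "{u}" X] A u by auto
    show "?m * a \<in> ?I \<E>" if "a \<in> ?I ((\<lambda>e. e - (A - {u})) ` \<E>)" for a
      using that A by (subst squarefree_ideal_colon) (auto simp: squarefree_ideal_iff)
    show "a \<in> ?I ((\<lambda>e. e - (A - {u})) ` \<E>)" if "a \<in> polys X" "?u * ?m * a \<in> ?I \<E>" for a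
    proof -
      have eq: "(\<lambda>e. e - {u}) ` \<E> = \<E>" using u(2) by force
      have "?u * (?m * a) \<in> ?I \<E>" using that(2) by (simp add: mult.assoc)
      then have "?m * a \<in> ?I \<E>"
        using squarefree_ideal_colon[of "{u}" X "?m * a" \<E>] A u(1) that(1) mX eq
        by (auto intro: polys_mult component_polys)
      then show ?thesis using squarefree_ideal_colon[of "A - {u}" X a \<E>] A that(1) by auto
    qed
    show "f \<in> ?I (insert A \<E>) \<longleftrightarrow> (\<exists>g\<in>?I \<E>. \<exists>a\<in>polys X. f = g + ?u * ?m * a)" for f
      unfolding um by (rule squarefree_ideal_insert[OF A])
  qed
  moreover have "\<forall>i\<ge>max N (Suc M). t i @ (case i of 0 \<Rightarrow> [] | Suc k \<Rightarrow> map (\<lambda>j. j + (?e + 1)) (s k)) = []"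
    using s(2) t(2) by (auto split: nat.split)
  moreover have "\<forall>i. \<forall>j\<in>set (t i @ (case i of 0 \<Rightarrow> [] | Suc k \<Rightarrow> map (\<lambda>j. j + (?e + 1)) (s k))). j - int i \<le> r"
    using s(3) t(3) unfolding e by (fastforce split: nat.splits)
  ultimately show ?thesis unfolding regularity_at_most_def by blast
qed

text \<open>The zero ideal: \<open>S\<close> resolves itself.\<close>

lemma regularity_at_most_empty:
  fixes K :: "'k::field itself" and X :: "'x set"
  assumes r: "0 \<le> r" shows "regularity_at_most K X {} r"
proof -
  let ?t = "\<lambda>i::nat. if i = 0 then [0::int] else []"
  let ?E = "\<lambda>i. 0\<^sub>m (length (?t i)) 0 :: ('x, 'k) mpoly mat"
  have nil: "free_vecs X 0 = {0\<^sub>v 0 :: ('x, 'k) mpoly vec}"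
    by (auto simp: free_vecs_iff)
  have "exact_chain X ?t ?E"
    by (auto simp: exact_chain_def nil graded_mat_def zero_mat_mult_vec)
  moreover have "minimal_chain ?t ?E" by (simp add: minimal_chain_def)
  moreover have "{v \<in> free_vecs X 1. v $ 0 \<in> (squarefree_ideal X {} :: ('x, 'k) mpoly set)}
    = (\<lambda>w. ?E 0 *\<^sub>v w) ` free_vecs X (length (?t 1))"
    by (auto simp: nil free_vecs_iff squarefree_ideal_iff zero_mat_mult_vec intro!: vec_1_eqI)
  ultimately have "minimal_ideal_resolution X (squarefree_ideal X {} :: ('x, 'k) mpoly set) ?t ?E"
    by (simp add: minimal_ideal_resolution_def)
  then show ?thesis
    unfolding regularity_at_most_def using r
    by (intro exI[of _ ?t] exI[of _ ?E] exI[of _ 1]) auto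
qed

section \<open>Forests and induced matchings\<close>

text \<open>No edge of \<open>E\<close> meets two different members of \<open>M\<close>. Taking \<open>g = e\<close> shows that the members are
pairwise disjoint.\<close>

definition induced_matching :: "'x set set \<Rightarrow> 'x set set \<Rightarrow> bool" where
  "induced_matching E M \<longleftrightarrow> M \<subseteq> E \<and>
     (\<forall>e\<in>M. \<forall>f\<in>M. e \<noteq> f \<longrightarrow> (\<forall>g\<in>E. g \<inter> e = {} \<or> g \<inter> f = {}))"

lemma induced_matchingD:
  "induced_matching E M \<Longrightarrow> e \<in> M \<Longrightarrow> f \<in> M \<Longrightarrow> e \<noteq> f \<Longrightarrow> g \<in> E \<Longrightarrow> g \<inter> e = {} \<or> g \<inter> f = {}"
  by (simp add: induced_matching_def)

lemma induced_matching_disjoint: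
  assumes M: "induced_matching E M" and fg: "f \<in> M" "g \<in> M" "f \<noteq> g"
  shows "f \<inter> g = {}"
proof -
  have "f \<in> E" using M fg by (auto simp: induced_matching_def)
  then have "f \<inter> f = {} \<or> f \<inter> g = {}" using M fg unfolding induced_matching_def by blast
  then show ?thesis by auto
qed

text \<open>For graphs this says that the edges form a forest: every nonempty set of edges has a vertex
that lies on only one of them. The property is inherited by subsets, as the induction over
edges requires.\<close>

definition has_leaves :: "'x set set \<Rightarrow> bool" where
  "has_leaves E \<longleftrightarrow> (\<forall>F\<subseteq>E. F \<noteq> {} \<longrightarrow> (\<exists>e\<in>F. \<exists>u\<in>e. u \<notin> \<Union>(F - {e})))"

text \<open>The regularity of the edge ideal of a forest is at most its induced matching number \<open>r\<close>. Let
\<open>e = {u, v}\<close> be an edge with a leaf \<open>u\<close>, and let \<open>J\<close> belong to the other edges. The ideal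
\<open>J : v\<close> is generated by the remaining neighbours of \<open>v\<close>, which are variables, and by the edges
that avoid \<open>v\<close> and these neighbours. Induced matchings in the latter set of edges stay induced
when \<open>e\<close> is added, so their size is at most \<open>r - 1\<close>, and the cone adds one to the regularity
of the colon ideal. The set \<open>Z\<close> of additional variables is needed to close the induction; a
variable outside all other generators does not change the regularity.\<close>

lemma regularity_forest:
  fixes K :: "'k::field itself" and X :: "'x set"
  assumes "finite Z" "finite E" "has_leaves E" "\<forall>e\<in>E. card e = 2" "Z \<inter> \<Union>E = {}" "Z \<union> \<Union>E \<subseteq> X"
    and "\<And>M. induced_matching E M \<Longrightarrow> card M \<le> r"
  shows "regularity_at_most K X ((\<lambda>z. {z}) ` Z \<union> E) (int r)"
  using assms
proof (induction "card Z + card E" arbitrary: Z E r rule: less_induct)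
  case less
  show ?case
  proof (cases "Z = {}")
    case False
    then obtain z where z: "z \<in> Z" by blast
    let ?Z = "Z - {z}"
    let ?A = "(\<lambda>z. {z}) ` ?Z \<union> E"
    have A: "(\<lambda>z. {z}) ` Z \<union> E = insert {z} ?A" using z by blast
    have zA: "z \<notin> \<Union>?A" using less.prems(5) z by auto
    have IH: "regularity_at_most K X ?A (int r)"
      using less.prems z card_Diff1_less[OF less.prems(1) z]
      by (intro less.hyps) (auto simp del: card_Diff_singleton)
    have "(\<lambda>e. e - ({z} - {z})) ` ?A = ?A" by simp
    then show ?thesis
      unfolding A using IH zA z less.prems(6)
      by (intro regularity_at_most_insert[where u = z]) auto
  next
    case Z: True
    show ?thesis
    proof (cases "E = {}")
      case True
      then show ?thesis using Z regularity_at_most_empty[of "int r" K X] by simp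
    next
      case False
      then obtain e u where e: "e \<in> E" "u \<in> e" "u \<notin> \<Union>(E - {e})"
        using less.prems(3) unfolding has_leaves_def by blast
      then obtain v where v: "e = {u, v}" "u \<noteq> v"
        using less.prems(4) by (metis card_2_iff insertE singletonD insert_commute)
      let ?E = "E - {e}"
      \<comment> \<open>The neighbours of \<open>v\<close> other than \<open>u\<close>, and the edges that survive in the colon ideal.\<close>
      define N where "N = {w. {v, w} \<in> ?E}"
      define E' where "E' = {f \<in> ?E. f \<inter> insert v N = {}}"
      have edge: "\<exists>w\<in>N. w \<noteq> v \<and> f = {v, w}" if fv: "f \<in> ?E" "v \<in> f" for f
      proof -
        have "card f = 2" using fv less.prems(4) by auto
        then obtain w where "f = {v, w}" "w \<noteq> v"
          using fv(2) by (metis card_2_iff insertE singletonD insert_commute)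
        then show ?thesis using fv by (auto simp: N_def)
      qed
      have "card {e} \<le> r"
        by (rule less.prems(7)) (use e in \<open>auto simp: induced_matching_def\<close>)
      then obtain r' where r: "r = Suc r'" by (cases r) auto
      have finE: "finite ?E" using less.prems(2) by simp
      have eX: "finite e" "e \<subseteq> X" using v e less.prems(6) by auto
      have N_E: "N \<subseteq> \<Union>?E" by (auto simp: N_def)
      have finN: "finite N"
      proof (rule finite_subset[OF N_E])
        have "finite f" if "f \<in> E" for f using that less.prems(4) by (metis card.infinite zero_neq_numeral)
        then show "finite (\<Union>?E)" using finE by auto
      qed
      have base: "regularity_at_most K X ((\<lambda>z. {z}) ` {} \<union> ?E) (int r)"
      proof (rule less.hyps)
        show "card {} + card ?E < card Z + card E"
          using e(1) less.prems(2) Z by (simp add: card_Diff1_less del: card_Diff_insert)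
        show "has_leaves ?E" using less.prems(3) unfolding has_leaves_def by (meson Diff_subset order_trans)
        fix M assume M: "induced_matching ?E M"
        \<comment> \<open>The removed edge could only join two members at \<open>v\<close>, but those are disjoint.\<close>
        have "induced_matching E M"
          unfolding induced_matching_def
        proof (intro conjI ballI impI)
          show "M \<subseteq> E" using M by (auto simp: induced_matching_def)
          fix f g h assume fg: "f \<in> M" "g \<in> M" "f \<noteq> g" "h \<in> E"
          have fE: "f \<in> ?E" "g \<in> ?E" using M fg by (auto simp: induced_matching_def)
          have fgE: "f \<inter> g = {}" by (rule induced_matching_disjoint[OF M fg(1-3)])
          show "h \<inter> f = {} \<or> h \<inter> g = {}"
          proof (cases "h = e")
            case True
            have "u \<notin> f" "u \<notin> g" using e(3) fE by auto
            then show ?thesis using fgE True v by auto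
          next
            case False
            then show ?thesis using M fg unfolding induced_matching_def by auto
          qed
        qed
        then show "card M \<le> r" by (rule less.prems(7))
      qed (use less.prems finE in auto)
      have col: "regularity_at_most K X ((\<lambda>z. {z}) ` N \<union> E') (int r')"
      proof (rule less.hyps)
        \<comment> \<open>Each neighbour in \<open>N\<close> accounts for an edge at \<open>v\<close> that is missing from \<open>E'\<close>.\<close>
        have "card N + card E' = card ((\<lambda>w. {v, w}) ` N) + card E'"
          by (subst card_image) (auto simp: inj_on_def doubleton_eq_iff)
        also have "\<dots> = card ((\<lambda>w. {v, w}) ` N \<union> E')"
          using finN finE by (intro card_Un_disjoint[symmetric]) (auto simp: E'_def)
        also have "\<dots> \<le> card ?E"
          using finE by (intro card_mono) (auto simp: N_def E'_def)
        also have "\<dots> < card E" using e(1) less.prems(2) by (simp add: card_Diff1_less del: card_Diff_insert)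
        finally show "card N + card E' < card Z + card E" by simp
        show "has_leaves E'" using less.prems(3) unfolding has_leaves_def E'_def by (metis (no_types, lifting) Diff_subset mem_Collect_eq order_trans subsetI subsetD)
        show "N \<inter> \<Union>E' = {}" by (auto simp: E'_def)
        show "N \<union> \<Union>E' \<subseteq> X" using N_E less.prems(6) by (auto simp: E'_def)
        fix M assume M: "induced_matching E' M"
        have "induced_matching E (insert e M)"
        proof -
          have 1: "g \<inter> e = {} \<or> g \<inter> f = {}" if f: "f \<in> M" and g: "g \<in> E" for f g
          proof -
            have fE: "f \<in> ?E" "f \<inter> insert v N = {}" using M f by (auto simp: induced_matching_def E'_def)
            have uf: "u \<notin> f" using e(3) fE(1) by auto
            show ?thesis
            proof (cases "g = e")
              case True
              then show ?thesis using uf fE(2) v by auto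
            next
              case False
              then have g': "g \<in> ?E" "u \<notin> g" using g e(3) by auto
              show ?thesis
              proof (cases "v \<in> g")
                case True
                then show ?thesis using edge[OF g'(1)] fE(2) by auto
              next
                case False
                then show ?thesis using g' v by auto
              qed
            qed
          qed
          have 2: "g \<inter> f = {} \<or> g \<inter> f' = {}" if ff: "f \<in> M" "f' \<in> M" "f \<noteq> f'" and g: "g \<in> E" for f f' g
          proof -
            have E': "f \<in> E'" "f' \<in> E'" using M ff by (auto simp: induced_matching_def)
            show ?thesis
            proof (cases "g \<in> E'")
              case True
              then show ?thesis using M ff unfolding induced_matching_def by blast
            next
              case False
              then consider "g = e" | "g \<in> ?E" "g \<inter> insert v N \<noteq> {}" using g by (auto simp: E'_def)
              then show ?thesis
              proof cases
                case 1
                then show ?thesis using E' e(3) v by (auto simp: E'_def)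
              next
                case 2
                show ?thesis
                proof (rule ccontr)
                  assume "\<not> ?thesis"
                  then obtain a b where ab: "a \<in> g" "a \<in> f" "b \<in> g" "b \<in> f'" by blast
                  obtain c where c: "c \<in> g" "c \<in> insert v N" using 2(2) by blast
                  have "c \<noteq> a" "c \<noteq> b" using E' ab c by (auto simp: E'_def)
                  moreover have "card g = 2" using 2(1) less.prems(4) by auto
                  ultimately have "a = b" using ab c by (auto simp: card_2_iff)
                  moreover have "f \<inter> f' = {}"
                    by (rule induced_matching_disjoint[OF M ff])
                  ultimately show False using ab by blast
                qed
              qed
            qed
          qed
          show ?thesis
            unfolding induced_matching_def
          proof (intro conjI ballI impI)
            show "insert e M \<subseteq> E" using M e(1) by (auto simp: induced_matching_def E'_def)
            fix f f' g assume "f \<in> insert e M" "f' \<in> insert e M" "f \<noteq> f'" "g \<in> E"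
            then consider "f = e" "f' \<in> M" | "f' = e" "f \<in> M" | "f \<in> M" "f' \<in> M" by blast
            then show "g \<inter> f = {} \<or> g \<inter> f' = {}"
              using 1[of f g] 1[of f' g] 2[of f f' g] \<open>f \<noteq> f'\<close> \<open>g \<in> E\<close> by cases auto
          qed
        qed
        then have "card (insert e M) \<le> r" by (rule less.prems(7))
        moreover have "e \<notin> M" "finite M"
          using M finE finite_subset[of M E'] by (auto simp: induced_matching_def E'_def)
        ultimately show "card M \<le> r'" using r by simp
      qed (use less.prems finE finN in \<open>auto simp: E'_def\<close>)
      have "regularity_at_most K X ((\<lambda>f. f - (e - {u})) ` ?E) (int r') =
            regularity_at_most K X ((\<lambda>z. {z}) ` N \<union> E') (int r')"
      proof (rule regularity_at_most_cong)
        have eu: "e - {u} = {v}" using v by auto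
        fix f assume "f \<in> (\<lambda>f. f - (e - {u})) ` ?E"
        then obtain g where g: "g \<in> ?E" "f = g - {v}" unfolding eu by blast
        show "\<exists>e'\<in>(\<lambda>z. {z}) ` N \<union> E'. e' \<subseteq> f"
        proof (cases "g \<in> E'")
          case True
          then show ?thesis using g by (intro bexI[of _ g]) (auto simp: E'_def)
        next
          case False
          have "\<exists>w\<in>N. w \<in> f"
          proof (cases "v \<in> g")
            case True
            then show ?thesis using edge[OF g(1)] g by auto
          next
            case False
            then show ?thesis using g \<open>g \<notin> E'\<close> by (auto simp: E'_def)
          qed
          then show ?thesis by blast
        qed
      next
        have eu: "e - {u} = {v}" using v by auto
        fix f assume f: "f \<in> (\<lambda>z. {z}) ` N \<union> E'"
        have "\<exists>g\<in>?E. g - {v} \<subseteq> f"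
        proof (cases "f \<in> E'")
          case True
          then show ?thesis by (intro bexI[of _ f]) (auto simp: E'_def)
        next
          case False
          then obtain w where "f = {w}" "{v, w} \<in> ?E" using f by (auto simp: N_def)
          then show ?thesis by (intro bexI[of _ "{v, w}"]) auto
        qed
        then show "\<exists>e'\<in>(\<lambda>f. f - (e - {u})) ` ?E. e' \<subseteq> f"
          by (simp add: eu)
      qed
      then have "regularity_at_most K X ((\<lambda>f. f - (e - {u})) ` ?E) (int r + 1 - int (card e))"
        using col r v by simp
      then have "regularity_at_most K X (insert e ?E) (int r)"
        using base eX e by (intro regularity_at_most_insert[where u = u]) auto
      moreover have "insert e ?E = E" using e(1) by blast
      ultimately show ?thesis using Z by simp
    qed
  qed
qed

lemma ideal_sum:
  assumes I: "ideal I (poly_ring X)" and "\<And>a. a \<in> A \<Longrightarrow> f a \<in> I"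
  shows "sum f A \<in> I"
  using assms(2) by (induction A rule: infinite_finite_induct) (auto intro: ideal_0[OF I] ideal_add[OF I])

lemma squarefree_monomial_pair: "u \<noteq> v \<Longrightarrow> variable u * variable v = squarefree_monomial {u, v}"
  using squarefree_monomial_Un[of "{u}" "{v}"] by (simp add: squarefree_monomial_singleton insert_commute)

text \<open>One inclusion holds since the right-hand side is an ideal; conversely each term of a
polynomial on the right is a multiple of the monomial of an edge.\<close>

lemma edge_ideal_squarefree:
  assumes "simple_graph G"
  shows "edge_ideal G = (squarefree_ideal (vertices G) (edges G) :: ('v, 'k::field) mpoly set)"
proof -
  let ?X = "vertices G"
  let ?S = "{variable u * variable v | u v. {u, v} \<in> edges G} :: ('v, 'k) mpoly set"
  interpret cring "poly_ring ?X :: ('v, 'k) mpoly ring" by (rule poly_ring_cring)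
  have ed: "e \<subseteq> ?X" "card e = 2" "finite e" if "e \<in> edges G" for e
    using assms that by (auto simp: simple_graph_def card_ge_0_finite)
  have S: "?S = squarefree_monomial ` edges G"
  proof (intro equalityI subsetI)
    fix f assume "f \<in> ?S"
    then obtain u v where uv: "f = variable u * variable v" "{u, v} \<in> edges G" by blast
    then have "u \<noteq> v" using ed(2)[OF uv(2)] by auto
    then have "f = squarefree_monomial {u, v}" using uv(1) by (simp add: squarefree_monomial_pair)
    then show "f \<in> squarefree_monomial ` edges G" using uv(2) by (rule image_eqI)
  next
    fix f assume "f \<in> (squarefree_monomial ` edges G :: ('v, 'k) mpoly set)"
    then obtain e where e: "e \<in> edges G" "f = squarefree_monomial e" by blast
    then obtain u v where uv: "e = {u, v}" "u \<noteq> v" using ed(2) by (meson card_2_iff)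
    then have "f = variable u * variable v" using e(2) by (simp add: squarefree_monomial_pair)
    then show "f \<in> ?S" using e(1) uv(1) by blast
  qed
  have Sc: "?S \<subseteq> polys ?X"
    unfolding S using component_polys[OF squarefree_monomial_component[OF ed(3) ed(1)]] by auto
  show ?thesis
  proof
    have "?S \<subseteq> squarefree_ideal ?X (edges G)"
      unfolding S
    proof
      fix f assume "f \<in> (squarefree_monomial ` edges G :: ('v, 'k) mpoly set)"
      then obtain e where e: "e \<in> edges G" "f = squarefree_monomial e" by blast
      then show "f \<in> squarefree_ideal ?X (edges G)"
        using Sc S by (auto simp: squarefree_ideal_iff squarefree_monomial_def keys_squarefree_exponent ed)
    qed
    then show "edge_ideal G \<subseteq> (squarefree_ideal ?X (edges G) :: ('v, 'k) mpoly set)"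
      unfolding edge_ideal_def by (rule genideal_minimal[OF squarefree_ideal_ideal])
    have id: "ideal (edge_ideal G :: ('v, 'k) mpoly set) (poly_ring ?X)"
      unfolding edge_ideal_def by (rule genideal_ideal[OF Sc])
    have gen: "squarefree_monomial e \<in> (edge_ideal G :: ('v, 'k) mpoly set)" if "e \<in> edges G" for e
      using genideal_self[OF Sc] that unfolding edge_ideal_def S by blast
    show "squarefree_ideal ?X (edges G) \<subseteq> (edge_ideal G :: ('v, 'k) mpoly set)"
    proof
      fix f :: "('v, 'k) mpoly" assume f: "f \<in> squarefree_ideal ?X (edges G)"
      have "Poly_Mapping.single m (Poly_Mapping.lookup f m) \<in> edge_ideal G"
        if m: "m \<in> Poly_Mapping.keys f" for m
      proof -
        obtain e where e: "e \<in> edges G" "e \<subseteq> Poly_Mapping.keys m"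
          using f m by (auto simp: squarefree_ideal_iff)
        have mX: "Poly_Mapping.keys m \<subseteq> ?X" using f m by (simp add: squarefree_ideal_iff polys_iff)
        have "Poly_Mapping.single m (Poly_Mapping.lookup f m) \<in> polys ?X"
          using mX by (simp add: polys_iff)
        then obtain a where "a \<in> polys ?X" "Poly_Mapping.single m (Poly_Mapping.lookup f m) = squarefree_monomial e * a"
          using squarefree_monomial_dvd[OF ed(3)[OF e(1)]] e(2) by (metis empty_iff keys_single singletonD)
        then show ?thesis using ideal_mult[OF id gen[OF e(1)]] by (simp add: mult.commute)
      qed
      then have "(\<Sum>m\<in>Poly_Mapping.keys f. Poly_Mapping.single m (Poly_Mapping.lookup f m)) \<in> edge_ideal G"
        by (rule ideal_sum[OF id])
      then show "f \<in> edge_ideal G" using poly_mapping_sum_single[of f] by simp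
    qed
  qed
qed

section \<open>Quotient modules and their regularity\<close>

lemma uminus_poly_ring:
  assumes "f \<in> polys X" shows "\<ominus>\<^bsub>poly_ring X\<^esub> f = - f"
proof -
  interpret cring "poly_ring X" by (rule poly_ring_cring)
  show ?thesis using assms minus_equality[of "- f" f] by (simp add: polys_uminus)
qed

lemma finsum_poly_ring:
  assumes "finite A" "\<And>a. a \<in> A \<Longrightarrow> f a \<in> polys X"
  shows "finsum (poly_ring X) f A = sum f A"
proof -
  interpret cring "poly_ring X" by (rule poly_ring_cring)
  show ?thesis using assms by (induction A rule: finite_induct) (auto simp: finsum_insert)
qed

abbreviation "quot_module X I \<equiv> quotient_module (poly_ring X) I"
abbreviation "residue X I f \<equiv> I +>\<^bsub>poly_ring X\<^esub> f"

context
  fixes X :: "'x set" and I :: "('x, 'k::field) mpoly set"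
  assumes I: "ideal I (poly_ring X)"
begin

lemma residue_eq_iff:
  assumes "f \<in> polys X" "g \<in> polys X" shows "residue X I f = residue X I g \<longleftrightarrow> f - g \<in> I"
proof -
  interpret cring "poly_ring X :: ('x, 'k) mpoly ring" by (rule poly_ring_cring)
  have "f \<ominus>\<^bsub>poly_ring X\<^esub> g = f - g"
    using assms by (simp add: a_minus_def uminus_poly_ring)
  then show ?thesis using quotient_eq_iff_same_a_r_cos[OF I assms] by simp
qed

lemma carrier_quotient: "carrier (quot_module X I) = residue X I ` polys X"
  by (auto simp: quotient_module_def FactRing_def A_RCOSETS_def')

lemma zero_quotient: "\<zero>\<^bsub>quot_module X I\<^esub> = residue X I 0"
proof -
  interpret ideal I "poly_ring X" by (rule I)
  have "\<zero>\<^bsub>quot_module X I\<^esub> = I" by (simp add: quotient_module_def FactRing_def)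
  also have "I = residue X I \<zero>\<^bsub>poly_ring X\<^esub>" using a_rcos_zero[OF I ideal_0[OF I]] by simp
  finally show ?thesis by simp
qed

text \<open>Sums in the quotient module are sums in the quotient ring, onto which taking residue classes
is a ring homomorphism.\<close>

lemma augmentation_residue:
  assumes v: "v \<in> free_vecs X (length (shifts F 0))"
    and f: "\<And>k. k < length (shifts F 0) \<Longrightarrow> f k \<in> polys X \<and> generators F ! k = residue X I (f k)"
  shows "augmentation (quot_module X I) F v = residue X I (\<Sum>k<length (shifts F 0). v $ k * f k)"
proof -
  let ?n = "length (shifts F 0)"
  interpret R: cring "poly_ring X :: ('x, 'k) mpoly ring" by (rule poly_ring_cring)
  interpret hom: ring_hom_cring "poly_ring X :: ('x, 'k) mpoly ring" "poly_ring X Quot I" "(+>\<^bsub>poly_ring X\<^esub>) I"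
    by (rule ideal.rcos_ring_hom_cring[OF I R.cring_axioms])
  have vf: "v $ k * f k \<in> polys X" if "k < ?n" for k
    using v f that by (auto simp: free_vecs_iff intro: polys_mult)
  have "augmentation (quot_module X I) F v = (\<Oplus>\<^bsub>poly_ring X Quot I\<^esub>k\<in>{..<?n}. v $ k \<odot>\<^bsub>quot_module X I\<^esub> generators F ! k)"
    by (simp add: augmentation_def finsum_def finprod_def quotient_module_def)
  also have "\<dots> = (\<Oplus>\<^bsub>poly_ring X Quot I\<^esub>k\<in>{..<?n}. residue X I (v $ k * f k))"
  proof (rule hom.S.finsum_cong')
    fix k assume "k \<in> {..<?n}"
    then have k: "k < ?n" by simp
    have "v $ k \<odot>\<^bsub>quot_module X I\<^esub> generators F ! k = residue X I (v $ k) \<otimes>\<^bsub>poly_ring X Quot I\<^esub> residue X I (f k)"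
      using f[OF k] by (simp add: quotient_module_def)
    also have "\<dots> = residue X I (v $ k \<otimes>\<^bsub>poly_ring X\<^esub> f k)"
      using v f[OF k] k by (intro hom.hom_mult[symmetric]) (auto simp: free_vecs_iff)
    finally show "v $ k \<odot>\<^bsub>quot_module X I\<^esub> generators F ! k = residue X I (v $ k * f k)" by simp
  qed (use vf hom.hom_closed in auto)
  also have "\<dots> = residue X I (finsum (poly_ring X) (\<lambda>k. v $ k * f k) {..<?n})"
    using vf by (subst hom.hom_finsum) (auto simp: comp_def)
  also have "\<dots> = residue X I (\<Sum>k<?n. v $ k * f k)"
    using vf by (subst finsum_poly_ring) auto
  finally show ?thesis .
qed

lemma free_module_vecs: "free_module X F i = free_vecs X (length (shifts F i))"
  by (simp add: free_module_def free_vecs_def)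

text \<open>Once representatives \<open>g\<close> of the generators are fixed, being a minimal resolution of \<open>S/I\<close> is a
condition on polynomial vectors only. Surjectivity of the augmentation reduces to hitting the
class of \<open>1\<close>.\<close>

lemma resolution_iff:
  assumes g: "graded_mat X (shifts F 0) [0] g" and len: "length (generators F) = length (shifts F 0)"
    and gen: "\<And>k. k < length (shifts F 0) \<Longrightarrow> generators F ! k = residue X I (g $$ (0, k))"
  shows "minimal_graded_free_resolution X (quot_module X I) (quotient_component X I) F \<longleftrightarrow>
    exact_chain X (shifts F) (differential F) \<and> minimal_chain (shifts F) (differential F) \<and>
    (\<exists>v\<in>free_vecs X (length (shifts F 0)). (g *\<^sub>v v) $ 0 - 1 \<in> I) \<and>
    {v \<in> free_vecs X (length (shifts F 0)). (g *\<^sub>v v) $ 0 \<in> I}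
       = (\<lambda>w. differential F 0 *\<^sub>v w) ` free_vecs X (length (shifts F 1))"
    (is "?L \<longleftrightarrow> ?R")
proof -
  let ?n = "length (shifts F 0)"
  have gp: "g $$ (0, k) \<in> poly_component X (shifts F 0 ! k)" if "k < ?n" for k
    using graded_mat_entry[OF g, of 0 k] that by simp
  have cg: "g \<in> carrier_mat 1 ?n" using graded_mat_carrier[OF g] by simp
  have gv: "(g *\<^sub>v v) $ 0 \<in> polys X" if "v \<in> free_vecs X ?n" for v
    using graded_mat_vec[OF g that] by (simp add: free_vecs_iff)
  have aug: "augmentation (quot_module X I) F v = residue X I ((g *\<^sub>v v) $ 0)" if v: "v \<in> free_vecs X ?n" for v
  proof -
    have "augmentation (quot_module X I) F v = residue X I (\<Sum>k<?n. v $ k * g $$ (0, k))"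
      using gp gen by (intro augmentation_residue v) (auto intro: component_polys)
    also have "(\<Sum>k<?n. v $ k * g $$ (0, k)) = (g *\<^sub>v v) $ 0"
      by (subst mult_mat_vec_entry[OF cg free_vecs_carrier[OF v]]) (simp_all add: mult.commute)
    finally show ?thesis .
  qed
  have gens: "generators F ! k \<in> quotient_component X I (shifts F 0 ! k)" if "k < ?n" for k
    using gen gp that by (auto simp: quotient_component_def)
  have ker: "{v \<in> free_vecs X ?n. augmentation (quot_module X I) F v = \<zero>\<^bsub>quot_module X I\<^esub>} = {v \<in> free_vecs X ?n. (g *\<^sub>v v) $ 0 \<in> I}"
  proof (rule Collect_cong, rule conj_cong[OF refl])
    fix v :: "('x, 'k) mpoly vec" assume v: "v \<in> free_vecs X ?n"
    show "augmentation (quot_module X I) F v = \<zero>\<^bsub>quot_module X I\<^esub> \<longleftrightarrow> (g *\<^sub>v v) $ 0 \<in> I"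
      unfolding aug[OF v] zero_quotient using residue_eq_iff[OF gv[OF v] polys_0] by simp
  qed
  have surj: "augmentation (quot_module X I) F ` free_vecs X ?n = carrier (quot_module X I) \<longleftrightarrow>
    (\<exists>v\<in>free_vecs X ?n. (g *\<^sub>v v) $ 0 - 1 \<in> I)"
  proof
    assume "augmentation (quot_module X I) F ` free_vecs X ?n = carrier (quot_module X I)"
    moreover have "residue X I 1 \<in> carrier (quot_module X I)" by (simp add: carrier_quotient)
    ultimately obtain v where v: "v \<in> free_vecs X ?n" "augmentation (quot_module X I) F v = residue X I 1" by (metis imageE)
    then have "(g *\<^sub>v v) $ 0 - 1 \<in> I" using aug gv residue_eq_iff[of "(g *\<^sub>v v) $ 0" 1] by simp
    then show "\<exists>v\<in>free_vecs X ?n. (g *\<^sub>v v) $ 0 - 1 \<in> I" using v(1) by blast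
  next
    assume "\<exists>v\<in>free_vecs X ?n. (g *\<^sub>v v) $ 0 - 1 \<in> I"
    then obtain v where v: "v \<in> free_vecs X ?n" "(g *\<^sub>v v) $ 0 - 1 \<in> I" by blast
    have "residue X I f \<in> augmentation (quot_module X I) F ` free_vecs X ?n" if f: "f \<in> polys X" for f
    proof
      show fv: "f \<cdot>\<^sub>v v \<in> free_vecs X ?n" using v(1) polys_mult[OF f] by (auto simp: free_vecs_iff)
      have "(g *\<^sub>v (f \<cdot>\<^sub>v v)) $ 0 = f * (g *\<^sub>v v) $ 0"
        using mult_mat_vec_entry[OF cg free_vecs_carrier[OF v(1)], of 0] free_vecs_carrier[OF v(1)]
        by (subst mult_mat_vec_entry[OF cg free_vecs_carrier[OF fv]])
          (auto simp: sum_distrib_left mult.left_commute intro!: sum.cong)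
      then have "f - (g *\<^sub>v (f \<cdot>\<^sub>v v)) $ 0 = (- f) * ((g *\<^sub>v v) $ 0 - 1)"
        by (simp add: algebra_simps)
      also have "\<dots> \<in> I" by (intro ideal_mult[OF I v(2)] polys_uminus f)
      finally show "residue X I f = augmentation (quot_module X I) F (f \<cdot>\<^sub>v v)"
        unfolding aug[OF fv] using residue_eq_iff[OF f gv[OF fv]] by simp
    qed
    moreover have "augmentation (quot_module X I) F ` free_vecs X ?n \<subseteq> carrier (quot_module X I)"
      using aug gv by (auto simp: carrier_quotient)
    ultimately show "augmentation (quot_module X I) F ` free_vecs X ?n = carrier (quot_module X I)" by (auto simp: carrier_quotient)
  qed
  have graded: "(\<forall>i. differential F i \<in> carrier_mat (length (shifts F i)) (length (shifts F (Suc i)))) \<and>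
     (\<forall>i. \<forall>r<length (shifts F i). \<forall>c<length (shifts F (Suc i)).
        differential F i $$ (r, c) \<in> poly_component X (shifts F (Suc i) ! c - shifts F i ! r))
    \<longleftrightarrow> (\<forall>i. graded_mat X (shifts F (Suc i)) (shifts F i) (differential F i))"
    unfolding graded_mat_def by blast
  have minimal: "(\<forall>i. elements_mat (differential F i) \<subseteq> irrelevant_ideal X) \<longleftrightarrow>
      minimal_chain (shifts F) (differential F)"
    if "\<forall>i. graded_mat X (shifts F (Suc i)) (shifts F i) (differential F i)"
  proof -
    have d: "graded_mat X (shifts F (Suc i)) (shifts F i) (differential F i)" for i using that by blast
    have el: "elements_mat (differential F i) =
        {differential F i $$ (r, c) | r c. r < length (shifts F i) \<and> c < length (shifts F (Suc i))}" for i
      using graded_mat_dim[OF d[of i]] by (auto simp: elements_mat_def) blast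
    have p: "differential F i $$ (r, c) \<in> polys X"
      if "r < length (shifts F i)" "c < length (shifts F (Suc i))" for i r c
      by (rule component_polys[OF graded_mat_entry[OF d that]])
    have "elements_mat (differential F i) \<subseteq> irrelevant_ideal X \<longleftrightarrow>
      (\<forall>r<length (shifts F i). \<forall>c<length (shifts F (Suc i)).
        Poly_Mapping.lookup (differential F i $$ (r, c)) 0 = 0)" for i
      unfolding el irrelevant_ideal_def using p by blast
    then show ?thesis by (simp add: minimal_chain_def)
  qed
  show ?thesis
    unfolding minimal_graded_free_resolution_def graded_free_resolution_def free_module_vecs
      exact_chain_def ker surj
    using len gens graded minimal by (simp only: One_nat_def) blast
qed

end

text \<open>The regularity is defined by a choice among all minimal resolutions; comparison with the given
finite one shows that the chosen resolution has no other shifts. It also shows that the maximum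
in the definition is taken over a finite set, which is nonempty because \<open>S/I\<close> is not zero.\<close>

lemma regularity_le:
  fixes I :: "('x, 'k::field) mpoly set"
  assumes I: "ideal I (poly_ring X)" and hI: "homogeneous_closed I" and one: "1 \<notin> I"
    and G: "minimal_ideal_resolution X I t E"
    and fin: "\<forall>i\<ge>N. t i = []" and r: "\<forall>i. \<forall>j\<in>set (t i). j - int i \<le> r"
  shows "regularity X (quotient_module (poly_ring X) I) (quotient_component X I) \<le> r"
proof -
  let ?M = "quotient_module (poly_ring X) I" and ?gr = "quotient_component X I"
  have t0: "t 0 = [0]" and ex: "exact_chain X t E" and min: "minimal_chain t E"
    and ker: "{v \<in> free_vecs X 1. v $ 0 \<in> I} = (\<lambda>w. E 0 *\<^sub>v w) ` free_vecs X (length (t 1))"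
    using G by (auto simp: minimal_ideal_resolution_def)
  define G where "G = \<lparr>shifts = t, differential = E, generators = [I +>\<^bsub>poly_ring X\<^esub> 1]\<rparr>"
  have one_v: "(1\<^sub>m 1 *\<^sub>v v) = v" if "v \<in> free_vecs X 1" for v :: "('x, 'k) mpoly vec"
    using one_mult_mat_vec[OF free_vecs_carrier[OF that]] .
  have "minimal_graded_free_resolution X ?M ?gr G"
  proof (subst resolution_iff[OF I, where g = "1\<^sub>m 1"])
    show "graded_mat X (shifts G 0) [0] (1\<^sub>m 1)"
      using graded_mat_one[of X "[0]"] by (simp add: G_def t0)
    have v1: "vec 1 (\<lambda>_. 1) \<in> free_vecs X 1" by (simp add: free_vecs_iff)
    have "\<exists>v\<in>free_vecs X 1. (1\<^sub>m 1 *\<^sub>v v) $ 0 - 1 \<in> I"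
      by (rule bexI[OF _ v1], subst one_v[OF v1]) (simp add: ideal_0[OF I])
    moreover have "{v \<in> free_vecs X 1. (1\<^sub>m 1 *\<^sub>v v) $ 0 \<in> I} = {v \<in> free_vecs X 1. v $ 0 \<in> I}"
      by (intro Collect_cong conj_cong refl) (subst one_v, auto)
    ultimately show "exact_chain X (shifts G) (differential G) \<and> minimal_chain (shifts G) (differential G) \<and>
        (\<exists>v\<in>free_vecs X (length (shifts G 0)). (1\<^sub>m 1 *\<^sub>v v) $ 0 - 1 \<in> I) \<and>
        {v \<in> free_vecs X (length (shifts G 0)). (1\<^sub>m 1 *\<^sub>v v) $ 0 \<in> I}
          = (\<lambda>w. differential G 0 *\<^sub>v w) ` free_vecs X (length (shifts G 1))"
      using ex min ker by (simp add: G_def t0)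
  qed (simp_all add: G_def t0)
  then have F: "minimal_graded_free_resolution X ?M ?gr (SOME F. minimal_graded_free_resolution X ?M ?gr F)"
    by (rule someI)
  define F where "F = (SOME F. minimal_graded_free_resolution X ?M ?gr F)"
  have F: "minimal_graded_free_resolution X ?M ?gr F" unfolding F_def by (rule F)
  let ?n = "length (shifts F 0)"
  have len: "length (generators F) = ?n" and gens: "\<And>k. k < ?n \<Longrightarrow> generators F ! k \<in> ?gr (shifts F 0 ! k)"
    using F by (auto simp: minimal_graded_free_resolution_def graded_free_resolution_def)
  have "\<forall>k. \<exists>f. k < ?n \<longrightarrow> f \<in> poly_component X (shifts F 0 ! k) \<and> generators F ! k = I +>\<^bsub>poly_ring X\<^esub> f"
    using gens by (fastforce simp: quotient_component_def)
  then obtain f where f: "\<And>k. k < ?n \<Longrightarrow> f k \<in> poly_component X (shifts F 0 ! k)"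
    "\<And>k. k < ?n \<Longrightarrow> generators F ! k = I +>\<^bsub>poly_ring X\<^esub> f k" by metis
  define g where "g = mat 1 ?n (\<lambda>(_, k). f k)"
  have g: "graded_mat X (shifts F 0) [0] g" using f(1) by (simp add: graded_mat_def g_def)
  have gk: "generators F ! k = I +>\<^bsub>poly_ring X\<^esub> g $$ (0, k)" if "k < ?n" for k
    using f(2)[OF that] that by (simp add: g_def)
  have Fex: "exact_chain X (shifts F) (differential F)" "minimal_chain (shifts F) (differential F)"
    "\<exists>v\<in>free_vecs X ?n. (g *\<^sub>v v) $ 0 - 1 \<in> I"
    "{v \<in> free_vecs X ?n. (g *\<^sub>v v) $ 0 \<in> I}
       = (\<lambda>w. differential F 0 *\<^sub>v w) ` free_vecs X (length (shifts F 1))"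
    using iffD1[OF resolution_iff[OF I g len gk] F] by blast+
  have sub: "set (shifts F i) \<subseteq> set (t i)" for i
    by (rule minimal_resolution_shifts[OF I hI Fex(1,2) g Fex(3,4) ex t0 ker])
  have reg: "regularity X ?M ?gr = Max {j - int i | i j. j \<in> set (shifts F i)}"
    by (simp add: regularity_def graded_betti_def F_def[symmetric] count_list_0_iff)
  have "?n \<noteq> 0"
  proof
    assume n: "?n = 0"
    obtain v where v: "v \<in> free_vecs X ?n" "(g *\<^sub>v v) $ 0 - 1 \<in> I" using Fex(3) by blast
    have "(g *\<^sub>v v) $ 0 = 0"
      using n mult_mat_vec_entry[of g 1 ?n v 0] free_vecs_carrier[OF v(1)] by (simp add: g_def)
    then have "- (0 - 1) \<in> I" using v(2) by (intro ideal_uminus[OF I]) simp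
    then show False using one by simp
  qed
  then have "\<exists>j. j \<in> set (shifts F 0)" by (metis length_0_conv list.set_sel(1))
  then have ne: "{j - int i | i j. j \<in> set (shifts F i)} \<noteq> {}" by blast
  have "{j - int i | i j. j \<in> set (shifts F i)} \<subseteq> (\<Union>i<N. (\<lambda>j. j - int i) ` set (t i))"
  proof
    fix x assume "x \<in> {j - int i | i j. j \<in> set (shifts F i)}"
    then obtain i j where ij: "x = j - int i" "j \<in> set (t i)" using sub by blast
    then have "i < N" using fin by (metis empty_iff empty_set not_le_imp_less)
    then show "x \<in> (\<Union>i<N. (\<lambda>j. j - int i) ` set (t i))" using ij by blast
  qed
  then have "finite {j - int i | i j. j \<in> set (shifts F i)}" by (rule finite_subset) simp
  from Max.boundedI[OF this ne] show ?thesis unfolding reg using sub r by blast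
qed

section \<open>Trees, whiskers and independent sets\<close>

lemma simple_graph_edge:
  assumes "simple_graph G" "e \<in> edges G"
  shows "e \<subseteq> vertices G" "card e = 2" "finite e"
  using assms by (auto simp: simple_graph_def card_ge_0_finite)

lemma simple_graph_pair:
  assumes "simple_graph G" "e \<in> edges G" "u \<in> e"
  obtains w where "e = {u, w}" "w \<noteq> u"
  using simple_graph_edge(2)[OF assms(1,2)] assms(3)
  by (metis card_2_iff insertE singletonD insert_commute)

lemma simple_graph_finite_edges: "simple_graph G \<Longrightarrow> finite (edges G)"
  by (rule finite_subset[of _ "Pow (vertices G)"]) (auto simp: simple_graph_def)

text \<open>An end \<open>u\<close> of a longest path is a leaf: a second edge at \<open>u\<close> would either close a cycle with
the path or extend it.\<close>

lemma forest_has_leaves: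
  assumes G: "simple_graph G" and acyc: "\<nexists>xs. graph_cycle G xs"
  shows "has_leaves (edges G)"
  unfolding has_leaves_def
proof (intro allI impI)
  fix F assume F: "F \<subseteq> edges G" "F \<noteq> {}"
  define P where "P xs \<longleftrightarrow> distinct xs \<and> 2 \<le> length xs \<and> set xs \<subseteq> vertices G \<and>
    (\<forall>i. Suc i < length xs \<longrightarrow> {xs ! i, xs ! Suc i} \<in> F)" for xs
  obtain e where e: "e \<in> F" using F by blast
  then obtain a b where ab: "e = {a, b}" "a \<noteq> b"
    using simple_graph_edge(2)[OF G] F by (meson card_2_iff subsetD)
  have "P [a, b]"
    using e ab F simple_graph_edge(1)[OF G, of e] by (auto simp: P_def less_Suc_eq)
  moreover have "length xs \<le> card (vertices G)" if "P xs" for xs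
  proof -
    have "card (set xs) \<le> card (vertices G)"
      using that G by (intro card_mono) (auto simp: P_def simple_graph_def)
    then show ?thesis using that by (simp add: P_def distinct_card)
  qed
  ultimately have "\<exists>xs. P xs \<and> (\<forall>ys. P ys \<longrightarrow> length ys \<le> length xs)"
    by (intro ex_has_greatest_nat[where b = "Suc (card (vertices G))"]) (auto simp: less_Suc_eq_le)
  then obtain xs where xs: "P xs" and max: "\<And>ys. P ys \<Longrightarrow> length ys \<le> length xs" by blast
  obtain u y zs where uy: "xs = u # y # zs"
    using xs by (cases xs; cases "tl xs") (auto simp: P_def)
  have e0: "{u, y} \<in> F" using xs uy by (force simp: P_def)
  have "u \<notin> \<Union>(F - {{u, y}})"
  proof
    assume "u \<in> \<Union>(F - {{u, y}})"
    then obtain g where g: "g \<in> F" "g \<noteq> {u, y}" "u \<in> g" by blast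
    then obtain w where w: "g = {u, w}" "w \<noteq> u" using simple_graph_pair[OF G] F by (metis subsetD)
    show False
    proof (cases "w \<in> set xs")
      case True
      then obtain k where k: "k < length xs" "xs ! k = w" by (auto simp: in_set_conv_nth)
      have "k \<noteq> 0" "k \<noteq> 1" using k w g uy by auto
      then have k2: "2 \<le> k" by simp
      let ?c = "take (Suc k) xs"
      have "last ?c = w" using k by (simp add: take_Suc_conv_app_nth)
      moreover have "hd ?c = u" using uy by simp
      moreover have "{w, u} \<in> edges G" using g w F by (auto simp: insert_commute)
      moreover have "walk G ?c"
        unfolding walk_def
      proof (intro conjI allI impI)
        show "?c \<noteq> []" using uy by simp
        show "set ?c \<subseteq> vertices G"
          using xs set_take_subset[of "Suc k" xs] unfolding P_def by blast
        fix i assume "Suc i < length ?c"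
        then have "Suc i < length xs" "?c ! i = xs ! i" "?c ! Suc i = xs ! Suc i" by auto
        then show "{?c ! i, ?c ! Suc i} \<in> edges G" using xs F(1) unfolding P_def by auto
      qed
      ultimately have "graph_cycle G ?c"
        using xs k k2 by (simp add: graph_cycle_def P_def)
      then show False using acyc by blast
    next
      case False
      have "P (w # xs)"
        unfolding P_def
      proof (intro conjI allI impI)
        show "set (w # xs) \<subseteq> vertices G"
          using xs simple_graph_edge(1)[OF G, of g] g(1) F w by (auto simp: P_def)
        fix i assume i: "Suc i < length (w # xs)"
        show "{(w # xs) ! i, (w # xs) ! Suc i} \<in> F"
        proof (cases i)
          case 0
          then show ?thesis using g w uy by (simp add: insert_commute)
        next
          case (Suc j)
          then show ?thesis using xs i by (simp add: P_def)
        qed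
      qed (use xs False in \<open>auto simp: P_def\<close>)
      then show False using max by fastforce
    qed
  qed
  then show "\<exists>e\<in>F. \<exists>u\<in>e. u \<notin> \<Union>(F - {e})" using e0 by blast
qed

lemma has_leaves_card:
  assumes "finite E" "has_leaves E" "\<forall>e\<in>E. card e = 2" "E \<noteq> {}"
  shows "card E + 1 \<le> card (\<Union>E)"
  using assms
proof (induction "card E" arbitrary: E)
  case 0
  then show ?case by simp
next
  case (Suc n)
  have "\<exists>e\<in>E. \<exists>u\<in>e. u \<notin> \<Union>(E - {e})"
    using Suc.prems(2,4) unfolding has_leaves_def by simp
  then obtain e u where e: "e \<in> E" "u \<in> e" "u \<notin> \<Union>(E - {e})" by blast
  have "finite f" if "f \<in> E" for f
    using that Suc.prems(3) by (metis card.infinite zero_neq_numeral)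
  then have finU: "finite (\<Union>E)" using Suc.prems(1) by auto
  show ?case
  proof (cases "E - {e} = {}")
    case True
    then have "E = {e}" using e by blast
    then show ?thesis using Suc.prems by simp
  next
    case False
    have n: "n = card (E - {e})" using Suc.hyps(2) e Suc.prems(1) by simp
    have "card (E - {e}) + 1 \<le> card (\<Union>(E - {e}))"
    proof (rule Suc.hyps(1)[OF n])
      show "has_leaves (E - {e})"
        using Suc.prems(2) unfolding has_leaves_def by (meson Diff_subset order_trans)
    qed (use Suc.prems False in auto)
    also have "\<dots> < card (\<Union>E)"
      using e finU by (intro psubset_card_mono) auto
    finally show ?thesis using n Suc.hyps(2) by simp
  qed
qed

definition independent_in :: "'v ugraph \<Rightarrow> 'v set \<Rightarrow> bool" where
  "independent_in G A \<longleftrightarrow> A \<subseteq> vertices G \<and> (\<forall>a\<in>A. \<forall>b\<in>A. {a, b} \<notin> edges G)"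

lemma whisker_edges:
  "edges (whisker G) = (\<lambda>e. Inl ` e) ` edges G \<union> (\<lambda>v. {Inl v, Inr v}) ` vertices G"
  and whisker_vertices: "vertices (whisker G) = Inl ` vertices G \<union> Inr ` vertices G"
  by (simp_all add: whisker_def)

lemma simple_graph_whisker: "simple_graph G \<Longrightarrow> simple_graph (whisker G)"
  unfolding simple_graph_def whisker_edges whisker_vertices
  by (auto simp: card_image inj_on_def)

text \<open>The end of a whisker lies on no other edge; a set of edges without whiskers comes from the
original graph.\<close>

lemma has_leaves_whisker:
  assumes "has_leaves (edges G)" shows "has_leaves (edges (whisker G))"
  unfolding has_leaves_def
proof (intro allI impI)
  fix F assume F: "F \<subseteq> edges (whisker G)" "F \<noteq> {}"
  show "\<exists>e\<in>F. \<exists>u\<in>e. u \<notin> \<Union>(F - {e})"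
  proof (cases "\<exists>v. {Inl v, Inr v} \<in> F")
    case True
    then obtain v where v: "{Inl v, Inr v} \<in> F" by blast
    have "Inr v \<notin> \<Union>(F - {{Inl v, Inr v}})"
      using F(1) unfolding whisker_edges by auto
    then show ?thesis using v by blast
  next
    case False
    define F0 where "F0 = {e \<in> edges G. Inl ` e \<in> F}"
    have F0: "F = (\<lambda>e. Inl ` e) ` F0"
    proof (intro equalityI subsetI)
      fix f assume f: "f \<in> F"
      then have "f \<notin> (\<lambda>v. {Inl v, Inr v}) ` vertices G" using False by auto
      then have "f \<in> (\<lambda>e. Inl ` e) ` edges G" using f F(1) unfolding whisker_edges by blast
      then show "f \<in> (\<lambda>e. Inl ` e) ` F0" using f by (auto simp: F0_def)
    qed (auto simp: F0_def)
    then have "F0 \<subseteq> edges G" "F0 \<noteq> {}" using F(2) by (auto simp: F0_def)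
    then have "\<exists>e\<in>F0. \<exists>u\<in>e. u \<notin> \<Union>(F0 - {e})"
      using assms unfolding has_leaves_def by simp
    then obtain e u where e: "e \<in> F0" "u \<in> e" "u \<notin> \<Union>(F0 - {e})" by blast
    have "Inl u \<notin> \<Union>(F - {Inl ` e})" using e(3) unfolding F0 by auto
    then show ?thesis using e F0 by blast
  qed
qed

text \<open>Every edge of the whiskered graph contains an original vertex. Choosing one from each edge of
an induced matching yields an independent set, since an edge between two chosen vertices would
meet two members of the matching.\<close>

lemma whisker_induced_matching:
  assumes G: "simple_graph G" and M: "induced_matching (edges (whisker G)) M"
  shows "\<exists>A. independent_in G A \<and> card A = card M"
proof -
  have "\<exists>v. v \<in> vertices G \<and> Inl v \<in> e" if e: "e \<in> M" for e
  proof -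
    have "e \<in> edges (whisker G)" using M e by (auto simp: induced_matching_def)
    then consider f where "f \<in> edges G" "e = Inl ` f" | v where "v \<in> vertices G" "e = {Inl v, Inr v}"
      unfolding whisker_edges by blast
    then show ?thesis
    proof cases
      case (1 f)
      then have "f \<noteq> {}" "f \<subseteq> vertices G" using simple_graph_edge[OF G] by fastforce+
      then show ?thesis using 1 by blast
    qed blast
  qed
  then obtain c where c: "\<And>e. e \<in> M \<Longrightarrow> c e \<in> vertices G" "\<And>e. e \<in> M \<Longrightarrow> Inl (c e) \<in> e" by metis
  have inj: "inj_on c M"
    using induced_matching_disjoint[OF M] c(2) by (intro inj_onI) (metis disjoint_iff)
  have "independent_in G (c ` M)"
    unfolding independent_in_def
  proof (intro conjI ballI notI)
    fix a b assume "a \<in> c ` M" "b \<in> c ` M" and ab: "{a, b} \<in> edges G"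
    then obtain e f where ef: "e \<in> M" "a = c e" "f \<in> M" "b = c f" by blast
    have "a \<noteq> b" using simple_graph_edge(2)[OF G ab] by auto
    then have "e \<noteq> f" using ef by auto
    moreover have g: "Inl ` {a, b} \<in> edges (whisker G)" using ab unfolding whisker_edges by blast
    ultimately have "Inl ` {a, b} \<inter> e = {} \<or> Inl ` {a, b} \<inter> f = {}"
      by (rule induced_matchingD[OF M ef(1,3)])
    moreover have "Inl a \<in> e" "Inl b \<in> f" using c(2) ef by auto
    ultimately show False by auto
  qed (use c in auto)
  then show ?thesis using card_image[OF inj] by blast
qed

lemma graph_dist_walk:
  assumes "walk_between G u xs v"
  obtains ys where "walk_between G u ys v" "length ys = Suc (graph_dist G u v)"
proof -
  have "xs \<noteq> []" using assms by (auto simp: walk_between_def walk_def)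
  then have "\<exists>k xs. walk_between G u xs v \<and> length xs = Suc k"
    using assms by (metis Suc_pred length_greater_0_conv)
  then have "\<exists>ys. walk_between G u ys v \<and> length ys = Suc (graph_dist G u v)"
    unfolding graph_dist_def by (rule LeastI_ex)
  then show thesis using that by blast
qed

lemma graph_dist_le:
  assumes "walk_between G u xs v" shows "Suc (graph_dist G u v) \<le> length xs"
proof -
  have "xs \<noteq> []" using assms by (auto simp: walk_between_def walk_def)
  then obtain k where k: "length xs = Suc k" by (cases xs) auto
  then have "graph_dist G u v \<le> k"
    unfolding graph_dist_def using assms by (intro Least_le) auto
  then show ?thesis using k by simp
qed

text \<open>A repeated vertex would allow the part of the walk between its two occurrences to be cut
out.\<close>

lemma shortest_walk_distinct:
  assumes w: "walk_between G u xs v" and len: "length xs = Suc (graph_dist G u v)"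
  shows "distinct xs"
proof (rule ccontr)
  assume "\<not> distinct xs"
  then obtain i j where ij: "i < j" "j < length xs" "xs ! i = xs ! j"
    by (metis distinct_conv_nth nat_neq_iff)
  let ?ys = "take i xs @ drop j xs"
  have l: "length ?ys = i + (length xs - j)" using ij by simp
  have nth: "?ys ! k = (if k < i then xs ! k else xs ! (k - i + j))" if "k < length ?ys" for k
    using that ij by (auto simp: nth_append add.commute)
  have "walk_between G u ?ys v"
    unfolding walk_between_def walk_def
  proof (intro conjI allI impI)
    show "?ys \<noteq> []" using ij by simp
    show "set ?ys \<subseteq> vertices G"
      using w by (auto simp: walk_between_def walk_def dest: in_set_takeD in_set_dropD)
    show "hd ?ys = u"
    proof (cases i)
      case 0
      have "xs ! 0 = u" using w by (metis walk_between_def walk_def hd_conv_nth)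
      then show ?thesis using 0 ij by (simp add: hd_drop_conv_nth)
    next
      case (Suc i')
      then show ?thesis using w ij by (cases xs) (auto simp: walk_between_def)
    qed
    show "last ?ys = v" using w ij by (simp add: walk_between_def)
    fix k assume k: "Suc k < length ?ys"
    have adj: "{xs ! m, xs ! Suc m} \<in> edges G" if "Suc m < length xs" for m
      using w that by (simp add: walk_between_def walk_def)
    show "{?ys ! k, ?ys ! Suc k} \<in> edges G"
    proof (cases "Suc k < i")
      case True
      then show ?thesis using adj[of k] ij k by (simp add: nth)
    next
      case False
      show ?thesis
      proof (cases "Suc k = i")
        case True
        then have "?ys ! k = xs ! k" "?ys ! Suc k = xs ! i" using k ij by (auto simp: nth)
        then show ?thesis using adj[of k] True ij by simp
      next
        case F: False
        then have "?ys ! k = xs ! (k - i + j)" "?ys ! Suc k = xs ! Suc (k - i + j)"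
          using k False by (auto simp: nth Suc_diff_le)
        moreover have "Suc (k - i + j) < length xs" using k l F False ij by linarith
        ultimately show ?thesis using adj by simp
      qed
    qed
  qed
  from graph_dist_le[OF this] show False using len l ij by linarith
qed

text \<open>Pair the vertices of the path at positions \<open>2k\<close> and \<open>2k + 1\<close>; an independent set contains at
most one of each pair.\<close>

lemma independent_card_path:
  assumes A: "independent_in G A" and w: "walk G xs" and d: "distinct xs"
  shows "card (A \<inter> set xs) \<le> Suc (length xs) div 2"
proof -
  let ?J = "{i. i < length xs \<and> xs ! i \<in> A}"
  have no: "\<not> (i \<in> ?J \<and> Suc i \<in> ?J)" for i
    using A w unfolding independent_in_def walk_def by auto
  have inj: "inj_on (\<lambda>i. i div 2) ?J"
  proof (rule inj_onI, rule ccontr)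
    fix i j assume ij: "i \<in> ?J" "j \<in> ?J" "i div 2 = j div 2" "i \<noteq> j"
    then have "j = Suc i \<or> i = Suc j" by linarith
    then show False using ij no[of i] no[of j] by blast
  qed
  have "A \<inter> set xs = (\<lambda>i. xs ! i) ` ?J" by (auto simp: in_set_conv_nth)
  then have "card (A \<inter> set xs) \<le> card ?J" by (simp add: card_image_le)
  also have "\<dots> = card ((\<lambda>i. i div 2) ` ?J)" using inj by (simp add: card_image)
  also have "\<dots> \<le> card {..<Suc (length xs) div 2}"
    by (rule card_mono) auto
  finally show ?thesis by simp
qed

text \<open>A shortest walk between vertices at maximal distance has \<open>d + 1\<close> distinct vertices, of which an
independent set contains at most about half.\<close>

lemma independent_card_diameter:
  assumes G: "simple_graph G" and con: "connected_graph G" and A: "independent_in G A"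
  shows "2 * card A + graph_diameter G \<le> 2 * card (vertices G)"
proof -
  let ?V = "vertices G" and ?d = "graph_diameter G"
  let ?D = "{graph_dist G u v | u v. u \<in> ?V \<and> v \<in> ?V}"
  have finV: "finite ?V" using G by (simp add: simple_graph_def)
  have "?D = (\<lambda>(u, v). graph_dist G u v) ` (?V \<times> ?V)" by auto
  then have "finite ?D" using finV by simp
  moreover have "?D \<noteq> {}" using con unfolding connected_graph_def by blast
  ultimately have "?d \<in> ?D" unfolding graph_diameter_def by (rule Max_in)
  then obtain u v where uv: "u \<in> ?V" "v \<in> ?V" "?d = graph_dist G u v" by auto
  then obtain ys where "walk_between G u ys v" using con by (auto simp: connected_graph_def)
  then obtain xs where xs: "walk_between G u xs v" "length xs = Suc ?d"
    using graph_dist_walk uv(3) by metis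
  have d: "distinct xs" using shortest_walk_distinct[OF xs(1)] xs(2) uv(3) by simp
  have w: "walk G xs" using xs by (simp add: walk_between_def)
  then have sub: "set xs \<subseteq> ?V" by (simp add: walk_def)
  have AV: "A \<subseteq> ?V" using A by (simp add: independent_in_def)
  have "A = (A \<inter> set xs) \<union> (A - set xs)" by blast
  then have "card A \<le> card (A \<inter> set xs) + card (A - set xs)" by (metis card_Un_le)
  also have "card (A \<inter> set xs) \<le> Suc (Suc ?d) div 2"
    using independent_card_path[OF A w d] xs(2) by simp
  also have "card (A - set xs) \<le> card (?V - set xs)"
    using AV finV by (intro card_mono) auto
  also have "card (?V - set xs) = card ?V - Suc ?d"
    using sub d xs(2) by (simp add: card_Diff_subset distinct_card)
  finally have "card A \<le> Suc (Suc ?d) div 2 + (card ?V - Suc ?d)" by simp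
  moreover have "Suc ?d \<le> card ?V"
    using card_mono[OF finV sub] distinct_card[OF d] xs(2) by simp
  ultimately show ?thesis by linarith
qed

lemma connected_vertex_edge:
  assumes con: "connected_graph G" and n: "2 \<le> card (vertices G)" and v: "v \<in> vertices G"
  shows "\<exists>e\<in>edges G. v \<in> e"
proof -
  have "vertices G \<noteq> {v}" using n by auto
  then obtain w where w: "w \<in> vertices G" "w \<noteq> v" using v by blast
  then obtain xs where xs: "walk_between G v xs w" using con v unfolding connected_graph_def by blast
  then obtain a b zs where "xs = a # b # zs"
    using w by (cases xs; cases "tl xs") (auto simp: walk_between_def walk_def)
  then have "{v, b} \<in> edges G" using xs by (force simp: walk_between_def walk_def)
  then show ?thesis by blast
qed

text \<open>The edges at the vertices of \<open>A\<close> are pairwise different, and each vertex of \<open>A\<close> that is not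
pendant has at least two of them. A tree has fewer edges than vertices.\<close>

lemma independent_card_pendant:
  assumes T: "is_tree G" and n: "2 \<le> card (vertices G)" and A: "independent_in G A"
  shows "2 * card A + 1 \<le> card (vertices G) + card (pendant_vertices G)"
proof -
  let ?V = "vertices G" and ?E = "edges G" and ?P = "pendant_vertices G"
  have G: "simple_graph G" and con: "connected_graph G" and acyc: "\<nexists>xs. graph_cycle G xs"
    using T by (auto simp: is_tree_def)
  have finV: "finite ?V" using G by (simp add: simple_graph_def)
  have finE: "finite ?E" by (rule simple_graph_finite_edges[OF G])
  have AV: "A \<subseteq> ?V" using A by (simp add: independent_in_def)
  have finA: "finite A" by (rule finite_subset[OF AV finV])
  have edge: "\<exists>e\<in>?E. v \<in> e" if "v \<in> ?V" for v using connected_vertex_edge[OF con n that] .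
  obtain v where "v \<in> ?V" using n by fastforce
  then have "?E \<noteq> {}" using edge by blast
  then have "card ?E + 1 \<le> card (\<Union>?E)"
    using has_leaves_card[OF finE forest_has_leaves[OF G acyc]] simple_graph_edge(2)[OF G] by blast
  also have "\<dots> \<le> card ?V" using simple_graph_edge(1)[OF G] finV by (intro card_mono) auto
  finally have E: "card ?E + 1 \<le> card ?V" .
  let ?S = "\<lambda>v. {e \<in> ?E. v \<in> e}"
  have disj: "?S a \<inter> ?S b = {}" if "a \<in> A" "b \<in> A" "a \<noteq> b" for a b
  proof -
    have False if e: "e \<in> ?E" "a \<in> e" "b \<in> e" for e
    proof -
      obtain w where "e = {a, w}" using simple_graph_pair[OF G e(1,2)] .
      then have "e = {a, b}" using e(3) \<open>a \<noteq> b\<close> by auto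
      then show False using A e(1) \<open>a \<in> A\<close> \<open>b \<in> A\<close> by (simp add: independent_in_def)
    qed
    then show ?thesis by blast
  qed
  have "(\<Sum>v\<in>A. card (?S v)) = card (\<Union>v\<in>A. ?S v)"
    using finA finE disj by (intro card_UN_disjoint[symmetric]) auto
  also have "\<dots> \<le> card ?E" using finE by (intro card_mono) auto
  finally have S: "(\<Sum>v\<in>A. card (?S v)) \<le> card ?E" .
  have deg: "2 \<le> card (?S v) + (if v \<in> ?P then 1 else 0)" if v: "v \<in> A" for v
  proof -
    have vV: "v \<in> ?V" using v AV by blast
    then have "?S v \<noteq> {}" using edge by blast
    then have "card (?S v) \<noteq> 0" using finE by simp
    moreover have "card (?S v) = 1 \<longleftrightarrow> v \<in> ?P"
      using vV by (simp add: pendant_vertices_def vertex_degree_def)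
    ultimately show ?thesis by auto
  qed
  have "2 * card A = (\<Sum>v\<in>A. 2)" by simp
  also have "\<dots> \<le> (\<Sum>v\<in>A. card (?S v) + (if v \<in> ?P then 1 else 0))"
    by (rule sum_mono) (rule deg)
  also have "\<dots> = (\<Sum>v\<in>A. card (?S v)) + card (A \<inter> ?P)"
    using finA by (simp add: sum.distrib sum.If_cases)
  also have "card (A \<inter> ?P) \<le> card ?P"
    using finV by (intro card_mono) (auto simp: pendant_vertices_def)
  finally show ?thesis using S E by linarith
qed

lemma independent_card_less:
  assumes con: "connected_graph G" and G: "simple_graph G" and n: "2 \<le> card (vertices G)"
    and A: "independent_in G A"
  shows "card A < card (vertices G)"
proof -
  obtain v where v: "v \<in> vertices G" using n by fastforce
  then obtain e where e: "e \<in> edges G" "v \<in> e" using connected_vertex_edge[OF con n] by blast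
  obtain w where w: "e = {v, w}" using simple_graph_pair[OF G e] .
  have "w \<in> vertices G" using simple_graph_edge(1)[OF G e(1)] w by blast
  then have "A \<noteq> vertices G" using A v e w by (auto simp: independent_in_def)
  then show ?thesis
    using A G by (intro psubset_card_mono) (auto simp: independent_in_def simple_graph_def)
qed

theorem theorem4p2:
  fixes T :: "'v ugraph"
    and n d p :: nat
    and X :: "('v + 'v) set"
    and S :: "('v + 'v, 'k::field) mpoly ring"
    and I :: "('v + 'v, 'k) mpoly set"
  assumes "is_tree T"
    and "n = card (vertices T)"
    and "n \<ge> 2"
    and "d = graph_diameter T"
    and "p = card (pendant_vertices T)"
    and "X = vertices (whisker T)"
    and "S = poly_ring X"
    and "I = edge_ideal (whisker T)"
  shows "regularity X (quotient_module S I) (quotient_component X I)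
           \<le> min \<lceil>(2 * real n - real d - 1) / 2\<rceil> \<lfloor>(2 * real n + real p - 2) / 3\<rfloor>"
proof -
  let ?W = "whisker T"
  let ?B = "min \<lceil>(2 * real n - real d - 1) / 2\<rceil> \<lfloor>(2 * real n + real p - 2) / 3\<rfloor>"
  have G: "simple_graph T" and con: "connected_graph T" and acyc: "\<nexists>xs. graph_cycle T xs"
    using \<open>is_tree T\<close> by (auto simp: is_tree_def)
  have W: "simple_graph ?W" by (rule simple_graph_whisker[OF G])
  have card_V: "2 \<le> card (vertices T)" using assms by simp
  have "p \<le> n"
    unfolding assms using G by (intro card_mono) (auto simp: pendant_vertices_def simple_graph_def)
  have ind: "int (card A) \<le> ?B" if A: "independent_in T A" for A
  proof -
    have "2 * card A + d \<le> 2 * n"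
      using independent_card_diameter[OF G con A] assms by simp
    then have "2 * real (card A) + real d \<le> 2 * real n" by linarith
    then have "int (card A) \<le> \<lceil>(2 * real n - real d - 1) / 2\<rceil>"
      by (simp add: le_ceiling_iff)
    \<comment> \<open>From \<open>2 |A| + 1 \<le> n + p\<close> this follows when \<open>p < n\<close>; if all vertices are pendant, it
      suffices that \<open>A\<close> is not the whole vertex set.\<close>
    moreover have "3 * card A + 2 \<le> 2 * n + p"
    proof (cases "p = n")
      case True
      then show ?thesis using independent_card_less[OF con G card_V A] assms by linarith
    next
      case False
      then show ?thesis
        using independent_card_pendant[OF \<open>is_tree T\<close> card_V A] \<open>p \<le> n\<close> assms by linarith
    qed
    then have "3 * real (card A) + 2 \<le> 2 * real n + real p" by linarith
    then have "int (card A) \<le> \<lfloor>(2 * real n + real p - 2) / 3\<rfloor>"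
      by (simp add: le_floor_iff)
    ultimately show ?thesis by simp
  qed
  \<comment> \<open>The bound on induced matchings is a natural number, hence the detour through \<open>nat\<close>.\<close>
  have B0: "0 \<le> ?B" using ind[of "{}"] by (simp add: independent_in_def)
  have IW: "I = squarefree_ideal X (edges ?W)"
    using edge_ideal_squarefree[OF W] assms by simp
  have "regularity_at_most TYPE('k) X ((\<lambda>z. {z}) ` {} \<union> edges ?W) (int (nat ?B))"
  proof (rule regularity_forest)
    show "finite (edges ?W)" by (rule simple_graph_finite_edges[OF W])
    show "has_leaves (edges ?W)" by (rule has_leaves_whisker[OF forest_has_leaves[OF G acyc]])
    show "\<forall>e\<in>edges ?W. card e = 2" using simple_graph_edge(2)[OF W] by blast
    show "{} \<union> \<Union>(edges ?W) \<subseteq> X" using simple_graph_edge(1)[OF W] assms by blast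
    fix M assume "induced_matching (edges ?W) M"
    then obtain A where A: "independent_in T A" "card A = card M"
      using whisker_induced_matching[OF G] by blast
    show "card M \<le> nat ?B" using nat_mono[OF ind[OF A(1)]] A(2) by (simp only: nat_int)
  qed auto
  then obtain t E N where t: "minimal_ideal_resolution X I t E" "\<forall>i\<ge>N. t i = []"
    "\<forall>i. \<forall>j\<in>set (t i). j - int i \<le> ?B"
    using B0 unfolding regularity_at_most_def IW by auto
  have "1 \<notin> I"
    using simple_graph_edge(2)[OF W, of "{}"] by (auto simp: IW squarefree_ideal_iff)
  then show ?thesis
    unfolding \<open>S = poly_ring X\<close>
    using t squarefree_ideal_ideal squarefree_ideal_homogeneous
    unfolding IW by (intro regularity_le) auto
qed

end
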